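(* Let $n\ge2$ and let $f_1,\dots,f_n:\mathbb{R}^p\to\mathbb{R}$ be differentiable functions such that, for every $i$ and all $x,y\in\mathbb{R}^p$, $$\|\nabla f_i(x)-\nabla f_i(y)\|\le L_i\|x-y\|,\qquad f_i(x)\ge f_i(y)+\langle\nabla f_i(y),x-y\rangle+\tfrac{\mu_i}{2}\|x-y\|^2,$$ with $L_i\in(0,\infty)$, $\mu_i\in[0,\infty)$, and at least one $\mu_i>0$. Put $L=\max_iL_i$, $\bar\mu=\frac1n\sum_{i=1}^n\mu_i$, $\bar\kappa=L/\bar\mu$, and let $x^*$ be the unique minimizer of $f=\frac1n\sum_{i=1}^nf_i$ and $\mathbf{x}^*=\mathbf{1}(x^* )^\top$. Let $\mathcal{A}(0),\mathcal{A}(1),\dots$ be the arc sets of a sequence of directed graphs (without self-loops) on $\{1,\dots,n\}$ for which there is an integer $\tilde B_\ominus>0$ such that, for every $t=0,1,\dots$, the directed graph with arc set $\bigcup_{\ell=t\tilde B_\ominus}^{(t+1)\tilde B_\ominus-1}\mathcal{A}(\ell)$ is strongly connected; put $B_\ominus=2\tilde B_\ominus-1$. Let $\mathbf{C}(k)=[C_{ij}(k)]\in\mathbb{R}^{n\times n}$ be given by $C_{ij}(k)=\frac{1}{d_j^{\mathrm{out}}(k)+1}$ if $j=i$ or $(j\to i)\in\mathcal{A}(k)$, and $C_{ij}(k)=0$ otherwise, where $d_j^{\mathrm{out}}(k)$ is the out-degree of $j$ in $\mathcal{A}(k)$. Let $\tilde\tau=\frac{1}{n^{2+nB_\ominus}}$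 and $Q_1=2n\frac{1+\tilde\tau^{-nB_\ominus}}{1-\tilde\tau^{nB_\ominus}}$, let $B$ be an integer large enough that $$\delta:=Q_1\left(1-\frac{1}{n^{(2+nB_\ominus)nB_\ominus}}\right)^{\frac{B-1}{nB_\ominus}}<1,$$ and define $$J_2=3Q_1\|\mathbf{V}^{-1}\|_{\max}^1\,\bar\kappa B\left(\delta+Q_1(B-1)\right)(1+\sqrt{n})\left(1+4\sqrt{n}\sqrt{\bar\kappa}\right),$$ where $\|\mathbf{V}^{-1}\|_{\max}^1=\sup_{k\ge0}\|(\mathbf{V}(k))^{-1}\|_{\max}$ (a finite quantity) and $\mathbf{V}(k)$ is the diagonal matrix appearing in the Push-DIGing algorithm. Then for any step-size $\alpha\in\left(0,\frac{1.5(1-\delta)^2}{\bar\mu J_2}\right]$ and any initial $\mathbf{x}(0)\in\mathbb{R}^{n\times p}$, the sequence $\{\mathbf{x}(k)\}$ generated by Push-DIGing converges to $\mathbf{x}^*$ at the global geometric rate $O(\lambda^k)$, i.e. there is a constant $C$ with $\|\mathbf{x}(k)-\mathbf{x}^*\|_F\le C\lambda^k$ for all $k\ge0$, where $$\lambda=\begin{cases}\sqrt[2B]{1-\frac{\alpha\bar\mu}{1.5}}, & \text{if } \alpha\in\left(0,\frac{1.5\left(\sqrt{J_2^2+(1-\delta^2)J_2}-\delta J_2\right)^2}{\bar\mu J_2(J_2+1)^2}\right],\\[2mm] \sqrt[B]{\sqrt{\frac{\alpha\bar\mu J_2}{1.5}}+\delta}, & \text{if } \alpha\in\left(\frac{1.5\left(\sqrt{J_2^2+(1-\delta^2)J_2}-\delta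 J_2\right)^2}{\bar\mu J_2(J_2+1)^2},\frac{1.5(1-\delta)^2}{\bar\mu J_2}\right].\end{cases}$$
   Context: $\mathbf{1}$ is the all-ones column vector in $\mathbb{R}^n$, $\|\cdot\|_F$ the Frobenius norm (Euclidean norm $\|\cdot\|$ on vectors), $\|\cdot\|_{\max}$ the entrywise maximum absolute value. For $\mathbf{x}\in\mathbb{R}^{n\times p}$ with rows $x_1^\top,\dots,x_n^\top$, $\nabla\mathbf{f}(\mathbf{x})\in\mathbb{R}^{n\times p}$ denotes the matrix whose $i$-th row is $(\nabla f_i(x_i))^\top$. Push-DIGing algorithm: with step-size $\alpha>0$, arbitrary $\mathbf{x}(0)=\mathbf{u}(0)\in\mathbb{R}^{n\times p}$, $\mathbf{y}(0)=\nabla\mathbf{f}(\mathbf{x}(0))$, $\mathbf{v}(0)=\mathbf{1}\in\mathbb{R}^n$, $\mathbf{V}(0)=\mathrm{diag}\{\mathbf{v}(0)\}$, for $k=0,1,\dots$ $$\mathbf{u}(k+1)=\mathbf{C}(k)(\mathbf{u}(k)-\alpha\mathbf{y}(k)),\quad \mathbf{v}(k+1)=\mathbf{C}(k)\mathbf{v}(k),\quad \mathbf{V}(k+1)=\mathrm{diag}\{\mathbf{v}(k+1)\},$$ $$\mathbf{x}(k+1)=(\mathbf{V}(k+1))^{-1}\mathbf{u}(k+1),\quad \mathbf{y}(k+1)=\mathbf{C}(k)\mathbf{y}(k)+\nabla\mathbf{f}(\mathbf{x}(k+1))-\nabla\mathbf{f}(\mathbf{x}(k)).$$ Under the stated assumptions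 every $\mathbf{V}(k)$ is invertible. *)

theory Defs
  imports "HOL-Analysis.Analysis"
begin

definition gradient :: "('a::real_inner \<Rightarrow> real) \<Rightarrow> 'a \<Rightarrow> 'a" where
  "gradient f x = (THE D. GDERIV f x :> D)"

text \<open>Matrices in n x p are of type \<open>real ^ 'p ^ 'n\<close>; on this type the library's \<open>norm\<close> is the
  Euclidean norm of all entries, i.e. the Frobenius norm.\<close>

definition gradient_rows ::
  "('n \<Rightarrow> real ^ 'p \<Rightarrow> real) \<Rightarrow> real ^ 'p ^ 'n \<Rightarrow> real ^ 'p::finite ^ 'n::finite" where
  "gradient_rows f x = (\<chi> i. gradient (f i) (x $ i))"

definition average_function :: "('n::finite \<Rightarrow> 'a \<Rightarrow> real) \<Rightarrow> 'a \<Rightarrow> real" where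
  "average_function f x = (1 / real CARD('n)) * (\<Sum>i\<in>UNIV. f i x)"

definition unique_minimizer :: "('a \<Rightarrow> real) \<Rightarrow> 'a" where
  "unique_minimizer F = (THE z. \<forall>w. F z \<le> F w)"

definition diag_matrix :: "real ^ 'n \<Rightarrow> real ^ 'n ^ 'n" where
  "diag_matrix v = (\<chi> i j. if i = j then v $ i else 0)"

definition max_abs_entry :: "real ^ 'm::finite ^ 'n::finite \<Rightarrow> real" where
  "max_abs_entry M = Max {\<bar>M $ i $ j\<bar> | i j. True}"

text \<open>An arc set consists of pairs \<open>(j, i)\<close>, standing for an arc from \<open>j\<close> to \<open>i\<close>;
  the vertex set is always the whole index type.\<close>

definition strongly_connected_arcs :: "('n \<times> 'n) set \<Rightarrow> bool" where
  "strongly_connected_arcs E \<longleftrightarrow> (\<forall>i j. (i, j) \<in> E\<^sup>*)"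

definition out_deg :: "('n \<times> 'n) set \<Rightarrow> 'n \<Rightarrow> nat" where
  "out_deg E j = card {i. (j, i) \<in> E}"

definition mixing_matrix :: "('n \<times> 'n) set \<Rightarrow> real ^ 'n ^ 'n::finite" where
  "mixing_matrix E =
     (\<chi> i j. if j = i \<or> (j, i) \<in> E then 1 / (real (out_deg E j) + 1) else 0)"

definition push_DIGing ::
  "('n::finite \<Rightarrow> real ^ 'p::finite \<Rightarrow> real) \<Rightarrow> (nat \<Rightarrow> real ^ 'n ^ 'n) \<Rightarrow> real \<Rightarrow>
   (nat \<Rightarrow> real ^ 'p ^ 'n) \<Rightarrow> (nat \<Rightarrow> real ^ 'n) \<Rightarrow> (nat \<Rightarrow> real ^ 'n ^ 'n) \<Rightarrow>
   (nat \<Rightarrow> real ^ 'p ^ 'n) \<Rightarrow> (nat \<Rightarrow> real ^ 'p ^ 'n) \<Rightarrow> bool" where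
  "push_DIGing f C \<alpha> u v V x y \<longleftrightarrow>
     u 0 = x 0 \<and> y 0 = gradient_rows f (x 0) \<and> v 0 = (\<chi> i. 1) \<and> V 0 = diag_matrix (v 0) \<and>
     (\<forall>k. u (Suc k) = C k ** (u k - \<alpha> *\<^sub>R y k) \<and>
          v (Suc k) = C k *v v k \<and>
          V (Suc k) = diag_matrix (v (Suc k)) \<and>
          x (Suc k) = matrix_inv (V (Suc k)) ** u (Suc k) \<and>
          y (Suc k) = C k ** y k + gradient_rows f (x (Suc k)) - gradient_rows f (x k))"

text \<open>In the constants below, \<open>n\<close> is the number of agents, \<open>Bo\<close> is $B_\ominus$, \<open>\<kappa>\<close> is
  $\bar\kappa$, \<open>\<mu>\<close> is $\bar\mu$ and \<open>vinv\<close> is $\sup_k \|V(k)^{-1}\|_{\max}$.\<close>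

definition tau_tilde :: "nat \<Rightarrow> nat \<Rightarrow> real" where
  "tau_tilde n Bo = 1 / real n ^ (2 + n * Bo)"

definition Q1_const :: "nat \<Rightarrow> nat \<Rightarrow> real" where
  "Q1_const n Bo =
     2 * real n * ((1 + inverse (tau_tilde n Bo ^ (n * Bo))) / (1 - tau_tilde n Bo ^ (n * Bo)))"

definition delta_const :: "nat \<Rightarrow> nat \<Rightarrow> nat \<Rightarrow> real" where
  "delta_const n Bo B =
     Q1_const n Bo *
       (1 - 1 / real n ^ ((2 + n * Bo) * (n * Bo))) powr ((real B - 1) / real (n * Bo))"

definition J2_const :: "nat \<Rightarrow> nat \<Rightarrow> nat \<Rightarrow> real \<Rightarrow> real \<Rightarrow> real" where
  "J2_const n Bo B \<kappa> vinv =
     3 * Q1_const n Bo * vinv * \<kappa> * real B *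
       (delta_const n Bo B + Q1_const n Bo * (real B - 1)) *
       (1 + sqrt (real n)) * (1 + 4 * sqrt (real n) * sqrt \<kappa>)"

definition alpha_switch :: "real \<Rightarrow> real \<Rightarrow> real \<Rightarrow> real" where
  "alpha_switch \<mu> \<delta> J =
     1.5 * (sqrt (J\<^sup>2 + (1 - \<delta>\<^sup>2) * J) - \<delta> * J)\<^sup>2 / (\<mu> * J * (J + 1)\<^sup>2)"

definition alpha_max :: "real \<Rightarrow> real \<Rightarrow> real \<Rightarrow> real" where
  "alpha_max \<mu> \<delta> J = 1.5 * (1 - \<delta>)\<^sup>2 / (\<mu> * J)"

definition rate :: "real \<Rightarrow> real \<Rightarrow> real \<Rightarrow> nat \<Rightarrow> real \<Rightarrow> real" where
  "rate \<mu> \<delta> J B \<alpha> =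
     (if \<alpha> \<le> alpha_switch \<mu> \<delta> J then root (2 * B) (1 - \<alpha> * \<mu> / 1.5)
      else root B (sqrt (\<alpha> * \<mu> * J / 1.5) + \<delta>))"

end

(* The stated rate is weak: every admissible step-size already gives decay like
   (1 - alpha mu / 4)^k, and (1 - alpha mu / 4)^(2B) <= 1 - alpha mu / 1.5 because B >= 2.  In the
   variables x and h = V^-1 y, Push-DIGing is gradient tracking with row stochastic matrices whose
   products over n Bt steps contract row spreads by 1 - n^(-n Bt), while the mean of u performs a
   gradient step for the average function whose error is at most the Lipschitz constant times the
   spread of x.  The distance of that mean to the minimizer and the spreads of x and h thus obey a
   linear recursion with nonnegative coefficients, and the size of J2 makes its loop gain small
   enough for a fixed weight vector to decay geometrically. *)

theory Submission
  imports Defs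
begin

subsection \<open>Products of mixing matrices\<close>

text \<open>Mixing with \<open>C k\<close> preserves sums of rows of \<open>u\<close>, so the
  natural mean of the rows of \<open>x\<close> has the changing weights \<open>v k\<close> / n;
  measuring disagreement by the diameter of the rows avoids singling out a mean. A single factor
  need not contract, yet gradient increments enter at every step; hence the seminorm over a window.
  With M = n Bt it contracts by c = n^(-M) / M per step. The spread of h feeds that of x, and the
  movement of x feeds that of h, so the loop gain is compared with c^2. Moreover the bias that the
  spread of x puts on the gradient step must stay below the contraction of that step, so the weight
  of this spread is of order 1/kappa. This turns the response of h to the distance into a term of
  order kappa (alpha L)^2, and alpha L sqrt(kappa) = alpha mu kappa^(3/2) has to be small: the
  source of the power of kappa. The powers of n are covered by the two factors Q1 in J2, each at
  least 4 n^(4 M).\<close>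

lemma mixing_matrix_nonneg: "0 \<le> mixing_matrix E $ i $ j"
  by (simp add: mixing_matrix_def)

text \<open>No vertex is its own out-neighbour, so \<open>out_deg E j + 1\<close> counts distinct
  vertices and is at most n.\<close>

lemma mixing_matrix_ge:
  fixes i j :: "'n::finite"
  assumes "\<And>i. (i, i) \<notin> E" and "j = i \<or> (j, i) \<in> E"
  shows "1 / real CARD('n) \<le> mixing_matrix E $ i $ j"
proof -
  have "insert j {i. (j, i) \<in> E} \<subseteq> UNIV" by simp
  then have "card (insert j {i. (j, i) \<in> E}) \<le> CARD('n)"
    by (intro card_mono) auto
  then have "real (out_deg E j) + 1 \<le> real CARD('n)"
    using assms(1) by (simp add: out_deg_def)
  then show ?thesis
    using assms(2) by (auto simp: mixing_matrix_def intro!: divide_left_mono)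
qed

lemma mixing_matrix_column_sum:
  assumes "\<And>i. (i, i) \<notin> E"
  shows "(\<Sum>i\<in>UNIV. mixing_matrix E $ i $ j) = 1"
proof -
  have "(\<Sum>i\<in>UNIV. mixing_matrix E $ i $ j)
      = (\<Sum>i\<in>insert j {i. (j, i) \<in> E}. 1 / (real (out_deg E j) + 1))"
    unfolding mixing_matrix_def by (rule sum.mono_neutral_cong_right) auto
  also have "\<dots> = 1"
    using assms by (simp add: out_deg_def)
  finally show ?thesis .
qed

text \<open>The product M(k+m-1) ... M(k), later factors on the left. Splitting off the earliest
  factor fits the shift of a window by one step; the next lemma splits off the latest one for
  inductions forward in time.\<close>

primrec backward_product :: "(nat \<Rightarrow> real ^ 'n ^ 'n) \<Rightarrow> nat \<Rightarrow> nat \<Rightarrow> real ^ 'n ^ 'n::finite" where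
  "backward_product M k 0 = mat 1"
| "backward_product M k (Suc m) = backward_product M (Suc k) m ** M k"

lemma backward_product_Suc':
  "backward_product M k (Suc m) = M (k + m) ** backward_product M k m"
proof (induction m arbitrary: k)
  case (Suc m)
  have "backward_product M k (Suc (Suc m)) = (M (Suc k + m) ** backward_product M (Suc k) m) ** M k"
    using Suc[of "Suc k"] by simp
  then show ?case by (simp add: matrix_mul_assoc)
qed simp

lemma backward_product_nonneg:
  assumes "\<And>k i j. 0 \<le> M k $ i $ j"
  shows "0 \<le> backward_product M k m $ i $ j"
  using assms
  by (induction m arbitrary: k i j)
     (auto simp: mat_def matrix_matrix_mult_def intro!: sum_nonneg mult_nonneg_nonneg)

lemma backward_product_vec:
  assumes "\<And>k. v (Suc k) = M k *v v k"
  shows "v (k + m) = backward_product M k m *v v k"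
proof (induction m)
  case (Suc m)
  then show ?case
    using assms[of "k + m"] by (simp del: backward_product.simps(2)
        add: backward_product_Suc' matrix_vector_mul_assoc)
qed simp

lemma rtrancl_closed_set:
  assumes "(i, j) \<in> E\<^sup>*" and "i \<in> X" and "\<And>a b. a \<in> X \<Longrightarrow> (a, b) \<in> E \<Longrightarrow> b \<in> X"
  shows "j \<in> X"
  using assms by (induction rule: rtrancl_induct) auto

text \<open>The set of reached vertices strictly grows during each connectivity window until it is
  everything; one extra window is lost to align the starting time \<open>k\<close> with a window.\<close>

lemma reach_everything:
  fixes S :: "nat \<Rightarrow> 'n::finite set" and A :: "nat \<Rightarrow> ('n \<times> 'n) set"
  assumes ne: "S k \<noteq> {}"
    and mono: "\<And>l. k \<le> l \<Longrightarrow> S l \<subseteq> S (Suc l)"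
    and arcs: "\<And>l a b. k \<le> l \<Longrightarrow> a \<in> S l \<Longrightarrow> (a, b) \<in> A l \<Longrightarrow> b \<in> S (Suc l)"
    and T: "T > 0"
    and connected: "\<And>t. strongly_connected_arcs (\<Union>l\<in>{t * T .. (t + 1) * T - 1}. A l)"
  shows "S (k + CARD('n) * T) = UNIV"
proof -
  have mono': "S l \<subseteq> S l'" if "k \<le> l" "l \<le> l'" for l l'
    using that(2) by (induction rule: dec_induct) (use mono that(1) in \<open>auto dest: le_trans\<close>)
  have grow: "S ((t + 1) * T) = UNIV \<or> card (S (t * T)) < card (S ((t + 1) * T))"
    if "k \<le> t * T" for t
  proof (cases "S ((t + 1) * T) = S (t * T)")
    case True
    \<comment> \<open>A set that is the same at both ends of the window absorbs every arc that
      occurs at any time inside it; strong connectivity of the union then leaves no vertex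
      outside.\<close>
    have closed: "b \<in> S (t * T)"
      if ab: "a \<in> S (t * T)" "(a, b) \<in> (\<Union>l\<in>{t * T .. (t + 1) * T - 1}. A l)" for a b
    proof -
      obtain l where l: "t * T \<le> l" "l \<le> (t + 1) * T - 1" "(a, b) \<in> A l"
        using ab(2) by auto
      have "Suc l \<le> (t + 1) * T" using l(2) T by (simp add: algebra_simps)
      moreover have "a \<in> S l" using mono'[of "t * T" l] l(1) \<open>k \<le> t * T\<close> ab(1) by auto
      ultimately have "b \<in> S ((t + 1) * T)"
        using arcs[of l a b] mono'[of "Suc l" "(t + 1) * T"] l \<open>k \<le> t * T\<close> by auto
      then show ?thesis using True by simp
    qed
    obtain a where "a \<in> S (t * T)" using ne mono'[of k "t * T"] \<open>k \<le> t * T\<close> by auto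
    have "b \<in> S (t * T)" for b
    proof -
      have "(a, b) \<in> (\<Union>l\<in>{t * T .. (t + 1) * T - 1}. A l)\<^sup>*"
        using connected[of t] by (simp only: strongly_connected_arcs_def)
      then show ?thesis using \<open>a \<in> S (t * T)\<close> closed by (rule rtrancl_closed_set)
    qed
    then show ?thesis using True by auto
  next
    case False
    then have "S (t * T) \<subset> S ((t + 1) * T)"
      using mono'[of "t * T" "(t + 1) * T"] that by auto
    then show ?thesis by (simp add: psubset_card_mono)
  qed
  define t0 where "t0 = k div T + 1"
  have "k mod T < T" "k div T * T + k mod T = k" "t0 * T = k div T * T + T"
    using T by (auto simp: t0_def)
  then have t0: "k \<le> t0 * T" "t0 * T \<le> k + T"
    by linarith+
  have card_ge: "S ((t0 + r) * T) = UNIV \<or> Suc r \<le> card (S ((t0 + r) * T))" for r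
  proof (induction r)
    case 0
    have "S (t0 * T) \<noteq> {}" using ne mono'[of k "t0 * T"] t0 by auto
    then show ?case by (simp add: Suc_le_eq card_gt_0_iff)
  next
    case (Suc r)
    have k: "k \<le> (t0 + r) * T" using t0(1) by (simp add: algebra_simps)
    from grow[OF k] show ?case
    proof
      assume "card (S ((t0 + r) * T)) < card (S ((t0 + r + 1) * T))"
      moreover have "S ((t0 + r) * T) \<subseteq> S ((t0 + r + 1) * T)"
        by (rule mono') (use k in auto)
      ultimately show ?thesis using Suc by auto
    qed simp
  qed
  \<comment> \<open>One vertex is present at the start, so n - 1 windows fill the set; the at most
    \<open>T\<close> steps up to \<open>t0 * T\<close> complete the n windows.\<close>
  have "S ((t0 + (CARD('n) - 1)) * T) = UNIV"
  proof -
    have "X = UNIV" if "X = UNIV \<or> Suc (CARD('n) - 1) \<le> card X" for X :: "'n set"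
      using that card_seteq[of UNIV X] by auto
    then show ?thesis using card_ge by blast
  qed
  moreover have "(t0 + (CARD('n) - 1)) * T \<le> k + CARD('n) * T"
  proof -
    have "CARD('n) * T = (CARD('n) - 1) * T + T" by (cases "CARD('n)") auto
    then show ?thesis using t0 by (simp add: add_mult_distrib del: One_nat_def)
  qed
  ultimately show ?thesis
    using mono'[of "(t0 + (CARD('n) - 1)) * T" "k + CARD('n) * T"] t0(1)
      mult_le_mono1[of t0 "t0 + (CARD('n) - 1)" T] order_trans
    by (metis UNIV_I le_add1 subsetI subset_antisym subset_UNIV)
qed

text \<open>For a fixed column \<open>j\<close>, the vertices whose entry after r factors is at
  least n^(-r) form a set that grows along the arcs: self-weights and arc weights are at least 1/n,
  and one term bounds a nonnegative sum from below. Then \<open>reach_everything\<close>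
  applies.\<close>

lemma mixing_product_ge:
  fixes A :: "nat \<Rightarrow> ('n::finite \<times> 'n) set"
  assumes no_loops: "\<And>k i. (i, i) \<notin> A k"
    and T: "T > 0"
    and connected: "\<And>t. strongly_connected_arcs (\<Union>l\<in>{t * T .. (t + 1) * T - 1}. A l)"
  shows "(1 / real CARD('n)) ^ (CARD('n) * T)
    \<le> backward_product (\<lambda>k. mixing_matrix (A k)) k (CARD('n) * T) $ i $ j"
proof -
  let ?P = "backward_product (\<lambda>k. mixing_matrix (A k)) k"
  define S where "S l = {i. (1 / real CARD('n)) ^ (l - k) \<le> ?P (l - k) $ i $ j}" for l
  have step: "b \<in> S (Suc l)" if "k \<le> l" "a \<in> S l" "a = b \<or> (a, b) \<in> A l" for l a b
  proof -
    have "1 / real CARD('n) * (1 / real CARD('n)) ^ (l - k)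
        \<le> mixing_matrix (A l) $ b $ a * ?P (l - k) $ a $ j"
      using that(2,3) no_loops
      by (intro mult_mono mixing_matrix_ge mixing_matrix_nonneg) (auto simp: S_def)
    also have "\<dots> \<le> (\<Sum>c\<in>UNIV. mixing_matrix (A l) $ b $ c * ?P (l - k) $ c $ j)"
      by (rule member_le_sum)
         (auto intro!: mult_nonneg_nonneg mixing_matrix_nonneg backward_product_nonneg)
    also have "\<dots> = ?P (Suc l - k) $ b $ j"
      using that(1) backward_product_Suc'[of "\<lambda>k. mixing_matrix (A k)" k "l - k"]
      by (simp add: Suc_diff_le matrix_matrix_mult_def del: backward_product.simps)
    finally show ?thesis using that(1) by (simp add: S_def Suc_diff_le)
  qed
  have "j \<in> S k" by (simp add: S_def mat_def)
  then have "S (k + CARD('n) * T) = UNIV"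
    by (intro reach_everything[where A = A] T connected) (use step in auto)
  then show ?thesis by (auto simp: S_def)
qed

subsection \<open>Spread of the rows and stochastic matrices\<close>

definition row_stochastic :: "real ^ 'm ^ 'n \<Rightarrow> bool" where
  "row_stochastic Q \<longleftrightarrow> (\<forall>i j. 0 \<le> Q $ i $ j) \<and> (\<forall>i. (\<Sum>j\<in>UNIV. Q $ i $ j) = 1)"

definition spread :: "real ^ 'p ^ 'n \<Rightarrow> real" where
  "spread z = diameter (range (($) z))"

lemma matrix_mult_row:
  fixes z :: "real ^ 'p ^ 'm"
  shows "(Q ** z) $ i = (\<Sum>j\<in>UNIV. Q $ i $ j *\<^sub>R z $ j)"
  by (simp add: matrix_matrix_mult_def vec_eq_iff)

lemma norm_row_diff_le_spread: "norm (z $ i - z $ j) \<le> spread (z :: real ^ 'p ^ 'n::finite)"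
  unfolding spread_def dist_norm[symmetric]
  by (intro diameter_bounded_bound finite_imp_bounded) auto

lemma spread_le:
  fixes z :: "real ^ 'p ^ 'n::finite"
  assumes "\<And>i j. norm (z $ i - z $ j) \<le> d"
  shows "spread z \<le> d"
  unfolding spread_def by (rule diameter_le) (use assms in auto)

lemma spread_nonneg: "0 \<le> spread (z :: real ^ 'p ^ 'n::finite)"
  using norm_row_diff_le_spread[of z undefined undefined] by simp

lemma spread_add: "spread (y + z) \<le> spread y + spread (z :: real ^ 'p ^ 'n::finite)"
proof (rule spread_le)
  fix i j
  have "norm ((y + z) $ i - (y + z) $ j) \<le> norm (y $ i - y $ j) + norm (z $ i - z $ j)"
    by (metis add_diff_add norm_triangle_ineq vector_add_component)
  then show "norm ((y + z) $ i - (y + z) $ j) \<le> spread y + spread z"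
    using norm_row_diff_le_spread[of y i j] norm_row_diff_le_spread[of z i j] by linarith
qed

lemma spread_scaleR: "spread (c *\<^sub>R z) \<le> \<bar>c\<bar> * spread (z :: real ^ 'p ^ 'n::finite)"
  by (rule spread_le)
     (simp add: norm_row_diff_le_spread mult_left_mono flip: scaleR_diff_right)

lemma spread_le_norm:
  fixes z :: "real ^ 'p ^ 'n::finite"
  assumes "\<And>i. norm (z $ i) \<le> d"
  shows "spread z \<le> 2 * d"
proof (rule spread_le)
  fix i j
  show "norm (z $ i - z $ j) \<le> 2 * d"
    using norm_triangle_ineq4[of "z $ i" "z $ j"] assms[of i] assms[of j] by linarith
qed

lemma norm_convex_combination_diff_le:
  fixes z :: "'i::finite \<Rightarrow> 'a::real_normed_vector"
  assumes "\<And>i. 0 \<le> w i" and "(\<Sum>i\<in>UNIV. w i) = 1" and "\<And>i. norm (z i - y) \<le> d"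
  shows "norm ((\<Sum>i\<in>UNIV. w i *\<^sub>R z i) - y) \<le> d"
proof -
  have "(\<Sum>i\<in>UNIV. w i *\<^sub>R z i) \<in> cball y d"
    by (rule convex_sum) (use assms in \<open>auto simp: dist_norm norm_minus_commute\<close>)
  then show ?thesis by (simp add: dist_norm norm_minus_commute)
qed

text \<open>Both sums are \<open>s\<close> times a convex combination of the same points, and
  convexity of balls, used twice, bounds the distance of two such combinations. Division by
  \<open>s\<close> is why zero mass is treated apart.\<close>

lemma norm_sum_diff_le:
  fixes z :: "'i::finite \<Rightarrow> 'a::real_normed_vector"
  assumes a: "\<And>i. 0 \<le> a i" "(\<Sum>i\<in>UNIV. a i) = s"
    and b: "\<And>i. 0 \<le> b i" "(\<Sum>i\<in>UNIV. b i) = s"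
    and z: "\<And>i j. norm (z i - z j) \<le> d"
  shows "norm ((\<Sum>i\<in>UNIV. a i *\<^sub>R z i) - (\<Sum>i\<in>UNIV. b i *\<^sub>R z i)) \<le> s * d"
proof (cases "s = 0")
  case True
  then have "a i = 0" "b i = 0" for i
    using a b sum_nonneg_eq_0_iff[of UNIV a] sum_nonneg_eq_0_iff[of UNIV b] by auto
  then show ?thesis using True by simp
next
  case False
  then have s: "s > 0" using a sum_nonneg[of UNIV a] by fastforce
  have *: "norm ((\<Sum>i\<in>UNIV. (a i / s) *\<^sub>R z i) - (\<Sum>i\<in>UNIV. (b i / s) *\<^sub>R z i)) \<le> d"
  proof (rule norm_convex_combination_diff_le)
    fix i
    have "norm ((\<Sum>j\<in>UNIV. (b j / s) *\<^sub>R z j) - z i) \<le> d"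
      by (rule norm_convex_combination_diff_le)
         (use b s z in \<open>auto simp flip: sum_divide_distrib\<close>)
    then show "norm (z i - (\<Sum>j\<in>UNIV. (b j / s) *\<^sub>R z j)) \<le> d"
      by (simp add: norm_minus_commute)
  qed (use a s in \<open>auto simp flip: sum_divide_distrib\<close>)
  have "(\<Sum>i\<in>UNIV. a i *\<^sub>R z i) - (\<Sum>i\<in>UNIV. b i *\<^sub>R z i)
      = s *\<^sub>R ((\<Sum>i\<in>UNIV. (a i / s) *\<^sub>R z i) - (\<Sum>i\<in>UNIV. (b i / s) *\<^sub>R z i))"
    using s by (simp add: scaleR_diff_right scaleR_sum_right)
  then show ?thesis using * s by (simp add: mult_left_mono)
qed

text \<open>Doeblin's argument: the common part \<open>w\<close> of the rows cancels in row differences.\<close>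

lemma spread_doeblin:
  fixes Q :: "real ^ 'n::finite ^ 'n" and z :: "real ^ 'p ^ 'n"
  assumes "\<And>i. (\<Sum>j\<in>UNIV. Q $ i $ j) = 1" and "\<And>i j. w j \<le> Q $ i $ j"
  shows "spread (Q ** z) \<le> (1 - (\<Sum>j\<in>UNIV. w j)) * spread z"
proof (rule spread_le)
  fix i i'
  have "(Q ** z) $ i - (Q ** z) $ i' =
      (\<Sum>j\<in>UNIV. (Q $ i $ j - w j) *\<^sub>R z $ j) - (\<Sum>j\<in>UNIV. (Q $ i' $ j - w j) *\<^sub>R z $ j)"
    by (simp add: matrix_mult_row scaleR_diff_left sum_subtractf)
  also have "norm \<dots> \<le> (1 - (\<Sum>j\<in>UNIV. w j)) * spread z"
    by (rule norm_sum_diff_le)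
       (use assms norm_row_diff_le_spread in \<open>auto simp: sum_subtractf\<close>)
  finally show "norm ((Q ** z) $ i - (Q ** z) $ i') \<le> (1 - (\<Sum>j\<in>UNIV. w j)) * spread z" .
qed

lemma spread_stochastic:
  fixes Q :: "real ^ 'n::finite ^ 'n" and z :: "real ^ 'p ^ 'n"
  assumes "row_stochastic Q"
  shows "spread (Q ** z) \<le> spread z"
  using spread_doeblin[of Q "\<lambda>_. 0" z] assms by (simp add: row_stochastic_def)

lemma row_stochastic_mat_1: "row_stochastic (mat 1)"
  by (simp add: row_stochastic_def mat_def)

lemma row_stochastic_mult:
  fixes P :: "real ^ 'm::finite ^ 'n::finite" and Q :: "real ^ 'l::finite ^ 'm"
  assumes "row_stochastic P" "row_stochastic Q"
  shows "row_stochastic (P ** Q)"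
proof -
  have "(\<Sum>j\<in>UNIV. (P ** Q) $ i $ j) = 1" for i
  proof -
    have "(\<Sum>j\<in>UNIV. (P ** Q) $ i $ j) = (\<Sum>k\<in>UNIV. P $ i $ k * (\<Sum>j\<in>UNIV. Q $ k $ j))"
      by (simp add: matrix_matrix_mult_def sum_distrib_left) (rule sum.swap)
    then show ?thesis using assms by (simp add: row_stochastic_def)
  qed
  then show ?thesis
    using assms by (auto simp: row_stochastic_def matrix_matrix_mult_def intro!: sum_nonneg)
qed

lemma row_stochastic_backward_product:
  assumes "\<And>k. row_stochastic (R k)"
  shows "row_stochastic (backward_product R k m)"
  by (induction m arbitrary: k) (simp_all add: row_stochastic_mat_1 row_stochastic_mult assms)

text \<open>A single factor need not shrink the spread. Adding up the spreads over a window of \<open>m\<close>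
  factors whose product does contract gives a seminorm that contracts at every step.\<close>

definition window_spread ::
  "(nat \<Rightarrow> real ^ 'n ^ 'n) \<Rightarrow> nat \<Rightarrow> nat \<Rightarrow> real ^ 'p ^ 'n::finite \<Rightarrow> real" where
  "window_spread R m k z = (\<Sum>l<m. spread (backward_product R k l ** z))"

lemma spread_le_window_spread:
  assumes "m > 0"
  shows "spread z \<le> window_spread R m k z"
  using member_le_sum[of 0 "{..<m}" "\<lambda>l. spread (backward_product R k l ** z)"] assms
  by (simp add: window_spread_def spread_nonneg)

lemma window_spread_le:
  assumes "\<And>k. row_stochastic (R k)"
  shows "window_spread R m k z \<le> real m * spread z"
  using sum_bounded_above[of "{..<m}" "\<lambda>l. spread (backward_product R k l ** z)" "spread z"]
  by (simp add: window_spread_def spread_stochastic row_stochastic_backward_product assms)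

lemma window_spread_nonneg: "0 \<le> window_spread R m k z"
  by (simp add: window_spread_def sum_nonneg spread_nonneg)

lemma window_spread_add:
  "window_spread R m k (y + z) \<le> window_spread R m k y + window_spread R m k z"
  unfolding window_spread_def matrix_add_ldistrib sum.distrib[symmetric]
  by (intro sum_mono spread_add)

lemma window_spread_scaleR: "window_spread R m k (c *\<^sub>R z) \<le> \<bar>c\<bar> * window_spread R m k z"
proof -
  have "backward_product R k l ** (c *\<^sub>R z) = c *\<^sub>R (backward_product R k l ** z)" for l
    by (simp add: vec_eq_iff matrix_mult_row sum_distrib_left algebra_simps)
  then show ?thesis
    unfolding window_spread_def sum_distrib_left by (auto intro!: sum_mono spread_scaleR)
qed

text \<open>Applying \<open>R k\<close> shifts the window: the summand \<open>spread z\<close>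
  leaves and the spread after all \<open>m\<close> factors enters, a loss of at least
  \<open>c * spread z\<close>. No summand exceeds \<open>spread z\<close>, which is therefore at
  least 1/m of the whole sum.\<close>

lemma window_spread_step:
  fixes z :: "real ^ 'p ^ 'n::finite"
  assumes R: "\<And>k. row_stochastic (R k)" and m: "m > 0" and c: "c \<ge> 0"
    and contr: "spread (backward_product R k m ** z) \<le> (1 - c) * spread z"
  shows "window_spread R m (Suc k) (R k ** z) \<le> (1 - c / real m) * window_spread R m k z"
proof -
  let ?s = "\<lambda>l. spread (backward_product R k l ** z)"
  have "window_spread R m (Suc k) (R k ** z) = (\<Sum>l<m. ?s (Suc l))"
    by (simp add: window_spread_def matrix_mul_assoc)
  also have "\<dots> = window_spread R m k z - spread z + ?s m"
    using sum.lessThan_Suc_shift[of ?s m] by (simp add: window_spread_def)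
  also have "\<dots> \<le> window_spread R m k z - c * spread z"
    using contr by (simp add: algebra_simps)
  also have "\<dots> \<le> window_spread R m k z - c * (window_spread R m k z / real m)"
    using window_spread_le[of R m k z, OF R] m c
    by (intro diff_left_mono mult_left_mono) (auto simp: field_simps)
  finally show ?thesis by (simp add: algebra_simps)
qed

subsection \<open>Push-sum weights\<close>

lemma push_sum_sum:
  fixes v :: "nat \<Rightarrow> real ^ 'n::finite"
  assumes "\<And>k j. (\<Sum>i\<in>UNIV. C k $ i $ j) = 1" and "v 0 = (\<chi> i. 1)"
    and "\<And>k. v (Suc k) = C k *v v k"
  shows "(\<Sum>i\<in>UNIV. v k $ i) = real CARD('n)"
proof (induction k)
  case (Suc k)
  have "(\<Sum>i\<in>UNIV. v (Suc k) $ i) = (\<Sum>j\<in>UNIV. \<Sum>i\<in>UNIV. C k $ i $ j * v k $ j)"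
    by (simp add: assms(3) matrix_vector_mult_def) (rule sum.swap)
  also have "\<dots> = real CARD('n)"
    using assms(1) Suc by (simp flip: sum_distrib_right)
  finally show ?case .
qed (simp add: assms)

text \<open>This is V(k+1)^-1 C(k) V(k), written entrywise to keep matrix inverses out of the mixing
  estimates.\<close>

definition normalized_matrix ::
  "(nat \<Rightarrow> real ^ 'n ^ 'n) \<Rightarrow> (nat \<Rightarrow> real ^ 'n) \<Rightarrow> nat \<Rightarrow> real ^ 'n ^ 'n::finite" where
  "normalized_matrix C v k = (\<chi> i j. C k $ i $ j * v k $ j / v (Suc k) $ i)"

lemma row_stochastic_normalized_matrix:
  assumes "\<And>k i. v k $ i > 0" and "\<And>k i j. 0 \<le> C k $ i $ j"
    and "\<And>k. v (Suc k) = C k *v v k"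
  shows "row_stochastic (normalized_matrix C v k)"
proof -
  have "(\<Sum>j\<in>UNIV. C k $ i $ j * v k $ j / v (Suc k) $ i) = 1" for i
  proof -
    have "(\<Sum>j\<in>UNIV. C k $ i $ j * v k $ j) = v (Suc k) $ i"
      by (simp add: assms(3) matrix_vector_mult_def)
    then show ?thesis
      using assms(1)[of "Suc k" i] by (simp flip: sum_divide_distrib)
  qed
  then show ?thesis
    using assms(1,2) by (simp add: row_stochastic_def normalized_matrix_def less_imp_le)
qed

text \<open>The inner diagonal matrices cancel in pairs, leaving V(k+m)^-1 C(k+m-1) ... C(k)
  V(k).\<close>

lemma backward_product_normalized_matrix:
  assumes "\<And>k i. v k $ i > 0"
  shows "backward_product (normalized_matrix C v) k m $ i $ j
    = backward_product C k m $ i $ j * v k $ j / v (k + m) $ i"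
proof (induction m arbitrary: k i j)
  case 0
  then show ?case using assms[of k i] by (auto simp: mat_def)
next
  case (Suc m)
  have "backward_product (normalized_matrix C v) k (Suc m) $ i $ j
      = (\<Sum>l\<in>UNIV. backward_product C (Suc k) m $ i $ l * v (Suc k) $ l / v (Suc k + m) $ i
          * (C k $ l $ j * v k $ j / v (Suc k) $ l))"
    by (simp only: backward_product.simps matrix_matrix_mult_def vec_lambda_beta Suc
        normalized_matrix_def)
  also have "\<dots> = (\<Sum>l\<in>UNIV. backward_product C (Suc k) m $ i $ l * C k $ l $ j
      * v k $ j / v (Suc k + m) $ i)"
    using assms[of "Suc k"] by (intro sum.cong) (auto simp: less_imp_neq[THEN not_sym])
  also have "\<dots> = backward_product C k (Suc m) $ i $ j * v k $ j / v (k + Suc m) $ i"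
    by (simp add: matrix_matrix_mult_def sum_distrib_right sum_divide_distrib)
  finally show ?case .
qed

text \<open>No weight exceeds the total mass n, so c v_j(k) / n bounds column \<open>j\<close> from
  below in every row. By conservation of mass these minorants add up to exactly \<open>c\<close>,
  and normalization costs no factor.\<close>

lemma spread_normalized_product:
  fixes z :: "real ^ 'p ^ 'n::finite"
  assumes pos: "\<And>k i. v k $ i > 0" and nonneg: "\<And>k i j. 0 \<le> C k $ i $ j"
    and v: "\<And>k. v (Suc k) = C k *v v k"
    and sum: "\<And>k. (\<Sum>i\<in>UNIV. v k $ i) = real CARD('n)"
    and c: "c \<ge> 0" "\<And>k i j. c \<le> backward_product C k m $ i $ j"
  shows "spread (backward_product (normalized_matrix C v) k m ** z) \<le> (1 - c) * spread z"
proof -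
  have le: "v k $ i \<le> real CARD('n)" for k i
    using member_le_sum[of i UNIV "\<lambda>i. v k $ i"] pos by (simp add: sum less_imp_le)
  have "spread (backward_product (normalized_matrix C v) k m ** z)
      \<le> (1 - (\<Sum>j\<in>UNIV. c * v k $ j / real CARD('n))) * spread z"
  proof (rule spread_doeblin)
    show "(\<Sum>j\<in>UNIV. backward_product (normalized_matrix C v) k m $ i $ j) = 1" for i
      using row_stochastic_backward_product[of "normalized_matrix C v" k m]
        row_stochastic_normalized_matrix[of v C, OF pos nonneg v]
      by (simp add: row_stochastic_def)
    show "c * v k $ j / real CARD('n) \<le> backward_product (normalized_matrix C v) k m $ i $ j" for i j
      unfolding backward_product_normalized_matrix[OF pos]
      by (intro frac_le mult_right_mono mult_nonneg_nonneg)
         (use c pos le in \<open>auto intro: less_imp_le order_trans\<close>)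
  qed
  also have "(\<Sum>j\<in>UNIV. c * v k $ j / real CARD('n)) = c"
    by (simp add: sum flip: sum_divide_distrib sum_distrib_left)
  finally show ?thesis .
qed

text \<open>Once n T steps have passed, every entry of the product of the last n T matrices is at
  least n^(-n T), and the mass it acts on is n. Before that, each vertex keeps at least 1/n of its
  own weight per step, which gives n^(-k).\<close>

lemma push_sum_ge:
  fixes v :: "nat \<Rightarrow> real ^ 'n::finite" and A :: "nat \<Rightarrow> ('n \<times> 'n) set"
  assumes no_loops: "\<And>k i. (i, i) \<notin> A k"
    and T: "T > 0"
    and connected: "\<And>t. strongly_connected_arcs (\<Union>l\<in>{t * T .. (t + 1) * T - 1}. A l)"
    and v0: "v 0 = (\<chi> i. 1)" and v: "\<And>k. v (Suc k) = mixing_matrix (A k) *v v k"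
  shows "(1 / real CARD('n)) ^ (CARD('n) * T) \<le> v k $ i"
proof -
  let ?n = "real CARD('n)" and ?M = "CARD('n) * T"
  have n: "?n \<ge> 1" by (simp add: Suc_le_eq)
  have nonneg: "0 \<le> v k $ i" for k i
    by (induction k arbitrary: i)
       (auto simp: v0 v matrix_vector_mult_def intro!: sum_nonneg mult_nonneg_nonneg mixing_matrix_nonneg)
  have small: "(1 / ?n) ^ k \<le> v k $ i" for k i
  proof (induction k)
    case (Suc k)
    have "(1 / ?n) * (1 / ?n) ^ k \<le> mixing_matrix (A k) $ i $ i * v k $ i"
      by (intro mult_mono mixing_matrix_ge mixing_matrix_nonneg) (use Suc no_loops in auto)
    also have "\<dots> \<le> (\<Sum>j\<in>UNIV. mixing_matrix (A k) $ i $ j * v k $ j)"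
      by (rule member_le_sum) (auto intro!: mult_nonneg_nonneg mixing_matrix_nonneg nonneg)
    finally show ?case by (simp add: v matrix_vector_mult_def)
  qed (simp add: v0)
  show ?thesis
  proof (cases "k \<le> ?M")
    case True
    then have "(1 / ?n) ^ ?M \<le> (1 / ?n) ^ k"
      using n by (intro power_decreasing) auto
    then show ?thesis using small[of k i] by linarith
  next
    case False
    let ?P = "backward_product (\<lambda>k. mixing_matrix (A k)) (k - ?M) ?M"
    have "(1 / ?n) ^ ?M \<le> (1 / ?n) ^ ?M * ?n"
      using n by (simp add: mult_le_cancel_left1)
    also have "\<dots> = (\<Sum>j\<in>UNIV. (1 / ?n) ^ ?M * v (k - ?M) $ j)"
      using push_sum_sum[of "\<lambda>k. mixing_matrix (A k)" v "k - ?M"] v0 v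
      by (simp add: mixing_matrix_column_sum no_loops flip: sum_distrib_left)
    also have "\<dots> \<le> (\<Sum>j\<in>UNIV. ?P $ i $ j * v (k - ?M) $ j)"
      by (intro sum_mono mult_right_mono mixing_product_ge no_loops T connected nonneg)
    also have "\<dots> = v k $ i"
      using backward_product_vec[of v "\<lambda>k. mixing_matrix (A k)" "k - ?M" ?M] v False
      by (simp add: matrix_vector_mult_def)
    finally show ?thesis .
  qed
qed

subsection \<open>Strongly convex functions\<close>

text \<open>\<open>gradient\<close> is a definite description, so existence and uniqueness are both
  due: the adjoint of the derivative, taken at 1, is the Riesz representative, and vectors with the
  same inner products agree.\<close>

lemma GDERIV_gradient:
  fixes f :: "'a::euclidean_space \<Rightarrow> real"
  assumes "f differentiable (at z)"
  shows "GDERIV f z :> gradient f z"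
proof -
  obtain f' where f': "(f has_derivative f') (at z)"
    using assms by (auto simp: differentiable_def)
  have "f' h = h \<bullet> adjoint f' 1" for h
    using adjoint_works[of f' h 1] has_derivative_linear[OF f'] by simp
  then have D: "GDERIV f z :> adjoint f' 1"
    using f' unfolding gderiv_def by (metis (no_types, lifting) ext)
  have "D' = adjoint f' 1" if "GDERIV f z :> D'" for D'
    using has_derivative_unique[OF that[unfolded gderiv_def] D[unfolded gderiv_def]]
    by (metis inner_commute vector_eq_ldot)
  with D show ?thesis
    unfolding gradient_def by (metis the_equality)
qed

text \<open>The minimizer is a definite description too. Existence comes from compactness of a ball,
  uniqueness from strong convexity at a critical point.\<close>

lemma gradient_unique_minimizer:
  fixes F :: "'a::euclidean_space \<Rightarrow> real"
  assumes deriv: "\<And>z. GDERIV F z :> G z"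
    and convex: "\<And>z w. F w + G w \<bullet> (z - w) + \<mu> / 2 * (norm (z - w))\<^sup>2 \<le> F z"
    and \<mu>: "\<mu> > 0"
  shows "G (unique_minimizer F) = 0"
proof -
  \<comment> \<open>Outside this radius the quadratic term of the lower bound at 0 outweighs the
    linear one, so \<open>F\<close> is at least \<open>F 0\<close> there.\<close>
  define r where "r = 2 * norm (G 0) / \<mu>"
  have "continuous_on (cball 0 r) F"
    using deriv by (auto simp: gderiv_def intro!: continuous_at_imp_continuous_on
        dest: has_derivative_continuous)
  moreover have "r \<ge> 0" using \<mu> by (simp add: r_def)
  ultimately obtain z where z: "z \<in> cball 0 r" "\<And>w. w \<in> cball 0 r \<Longrightarrow> F z \<le> F w"
    using continuous_attains_inf[of "cball 0 r" F] by auto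
  have min: "F z \<le> F w" for w
  proof (cases "w \<in> cball 0 r")
    case False
    then have "norm (G 0) \<le> \<mu> / 2 * norm w" using \<mu> by (simp add: r_def field_simps)
    then have "norm (G 0) * norm w \<le> \<mu> / 2 * (norm w)\<^sup>2"
      by (metis mult.assoc mult_right_mono norm_ge_zero power2_eq_square)
    moreover have "- (norm (G 0) * norm w) \<le> G 0 \<bullet> w"
      using Cauchy_Schwarz_ineq2[of "G 0" w] by linarith
    ultimately have "F 0 \<le> F w" using convex[of 0 w] by simp
    then show ?thesis using z(2)[of 0] \<open>r \<ge> 0\<close> by simp
  qed (simp add: z)
  have "(\<lambda>h. h \<bullet> G z) = (\<lambda>h. 0)"
    using deriv[of z] by (intro has_derivative_local_min[of F]) (auto simp: gderiv_def min)
  then have G: "G z = 0" by (metis inner_eq_zero_iff)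
  have "w = z" if "\<forall>w'. F w \<le> F w'" for w
  proof -
    have "\<mu> * (norm (w - z))\<^sup>2 \<le> 0"
      using convex[of z w] spec[OF that, of z] G by simp
    then show ?thesis using \<mu> by (simp add: mult_le_0_iff)
  qed
  then have "unique_minimizer F = z"
    unfolding unique_minimizer_def using min by (intro the_equality) auto
  then show ?thesis using G by simp
qed

text \<open>Strong convexity at 0 and at a unit vector, added, bounds \<open>\<mu>\<close> by the
  change of \<open>G\<close> between them. It serves to show that kappa is at least 1.\<close>

lemma strong_convexity_le_Lipschitz:
  fixes F :: "'a::euclidean_space \<Rightarrow> real"
  assumes convex: "\<And>z w. F w + G w \<bullet> (z - w) + \<mu> / 2 * (norm (z - w))\<^sup>2 \<le> F z"
    and smooth: "\<And>z w. norm (G z - G w) \<le> L * norm (z - w)"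
  shows "\<mu> \<le> L"
proof -
  obtain b :: 'a where b: "norm b = 1" using vector_choose_size[of 1] by auto
  have "\<mu> \<le> (G b - G 0) \<bullet> b"
    using convex[of 0 b] convex[of b 0] b by (simp add: inner_diff_left)
  also have "\<dots> \<le> norm (G b - G 0) * norm b" by (rule norm_cauchy_schwarz)
  also have "\<dots> \<le> L" using smooth[of b 0] b by simp
  finally show ?thesis .
qed

text \<open>Convexity at \<open>z - G z / (2 L)\<close> replaces the descent lemma and costs only a factor 2.\<close>

lemma norm_gradient_le:
  fixes F :: "'a::real_inner \<Rightarrow> real"
  assumes convex: "\<And>z w. F w + G w \<bullet> (z - w) \<le> F z"
    and smooth: "\<And>z w. norm (G z - G w) \<le> L * norm (z - w)"
    and L: "L > 0" and min: "\<And>w. m \<le> F w"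
  shows "(norm (G z))\<^sup>2 \<le> 4 * L * (F z - m)"
proof -
  define w where "w = z - (1 / (2 * L)) *\<^sub>R G z"
  have zw: "z - w = (1 / (2 * L)) *\<^sub>R G z" by (simp add: w_def)
  have "norm (G z - G w) \<le> norm (G z) / 2"
    using smooth[of z w] L by (simp add: zw)
  then have "(G z - G w) \<bullet> G z \<le> norm (G z) / 2 * norm (G z)"
    by (metis mult_right_mono norm_cauchy_schwarz norm_ge_zero order_trans)
  then have "(norm (G z))\<^sup>2 \<le> 2 * (G w \<bullet> G z)"
    by (simp add: inner_diff_left power2_norm_eq_inner power2_eq_square[of "norm _"]
        flip: power2_norm_eq_inner)
  moreover have "m + (1 / (2 * L)) * (G w \<bullet> G z) \<le> F z"
    using convex[of w z] min[of w] by (simp add: zw)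
  ultimately show ?thesis using L by (simp add: field_simps)
qed

text \<open>When the square is expanded, the term alpha^2 |G z|^2 is paid by the gap in function
  values, through \<open>norm_gradient_le\<close> and 2 alpha L \<le> 1. The quadratic part of
  strong convexity is left over and yields the factor 1 - alpha mu for the square.\<close>

lemma gradient_step_contraction:
  fixes F :: "'a::real_inner \<Rightarrow> real"
  assumes convex: "\<And>z w. F w + G w \<bullet> (z - w) + \<mu> / 2 * (norm (z - w))\<^sup>2 \<le> F z"
    and smooth: "\<And>z w. norm (G z - G w) \<le> L * norm (z - w)"
    and L: "L > 0" and \<mu>: "\<mu> \<ge> 0" and x: "G x = 0"
    and \<alpha>: "\<alpha> \<ge> 0" "2 * \<alpha> * L \<le> 1" "\<alpha> * \<mu> \<le> 1"
  shows "norm (z - \<alpha> *\<^sub>R G z - x) \<le> (1 - \<alpha> * \<mu> / 2) * norm (z - x)"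
proof (rule power2_le_imp_le)
  have min: "F x \<le> F w" for w
    using convex[of x w] x \<mu> by (smt (verit) inner_zero_left mult_nonneg_nonneg zero_le_power2 divide_nonneg_nonneg)
  have conv: "F w + G w \<bullet> (z - w) \<le> F z" for z w
    using convex[of w z] \<mu> by (smt (verit) mult_nonneg_nonneg zero_le_power2 divide_nonneg_nonneg)
  have G: "(norm (G z))\<^sup>2 \<le> 4 * L * (F z - F x)"
    by (rule norm_gradient_le[of F, OF conv smooth L min])
  have "\<alpha>\<^sup>2 * (norm (G z))\<^sup>2 \<le> \<alpha>\<^sup>2 * (4 * L * (F z - F x))"
    using G by (intro mult_left_mono) auto
  also have "\<dots> = (2 * \<alpha> * L) * (2 * \<alpha> * (F z - F x))"
    by (simp add: power2_eq_square)
  also have "\<dots> \<le> 2 * \<alpha> * (F z - F x)"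
    using \<alpha> L min[of z] by (intro mult_left_le_one_le) auto
  finally have 1: "\<alpha>\<^sup>2 * (norm (G z))\<^sup>2 \<le> 2 * \<alpha> * (F z - F x)" .
  have "F z - F x + \<mu> / 2 * (norm (z - x))\<^sup>2 \<le> G z \<bullet> (z - x)"
    using convex[of z x] by (simp add: inner_diff_right norm_minus_commute)
  then have 2: "2 * \<alpha> * (F z - F x + \<mu> / 2 * (norm (z - x))\<^sup>2) \<le> 2 * \<alpha> * (G z \<bullet> (z - x))"
    using \<alpha> by (intro mult_left_mono) auto
  have "(norm (z - \<alpha> *\<^sub>R G z - x))\<^sup>2 = (norm ((z - x) - \<alpha> *\<^sub>R G z))\<^sup>2"
    by (simp add: algebra_simps)
  also have "\<dots> = (norm (z - x))\<^sup>2 - 2 * \<alpha> * (G z \<bullet> (z - x)) + \<alpha>\<^sup>2 * (norm (G z))\<^sup>2"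
    unfolding power2_norm_eq_inner
    by (simp add: inner_diff_left inner_diff_right inner_commute power2_eq_square algebra_simps)
  also have "\<dots> \<le> (1 - \<alpha> * \<mu>) * (norm (z - x))\<^sup>2"
    using 1 2 by (simp add: algebra_simps)
  also have "1 - \<alpha> * \<mu> \<le> (1 - \<alpha> * \<mu> / 2)\<^sup>2"
    using zero_le_power2[of "\<alpha> * \<mu> / 2"] by (simp add: power2_diff)
  finally have "(norm (z - \<alpha> *\<^sub>R G z - x))\<^sup>2 \<le> (1 - \<alpha> * \<mu> / 2)\<^sup>2 * (norm (z - x))\<^sup>2"
    by (simp add: mult_right_mono)
  then show "(norm (z - \<alpha> *\<^sub>R G z - x))\<^sup>2 \<le> ((1 - \<alpha> * \<mu> / 2) * norm (z - x))\<^sup>2"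
    by (simp only: power_mult_distrib)
  show "0 \<le> (1 - \<alpha> * \<mu> / 2) * norm (z - x)" using \<alpha> by auto
qed

subsection \<open>The error recursion\<close>

text \<open>A nonnegative linear recursion decays at the rate \<open>1 - t / 4\<close> because the weight vector
  \<open>(1, A, D)\<close> is mapped below \<open>1 - t / 4\<close> times itself.\<close>

lemma coupled_recursion_decay:
  fixes e a b :: "nat \<Rightarrow> real"
  assumes e: "\<And>k. e (Suc k) \<le> (1 - t / 2) * e k + p * a k"
    and a: "\<And>k. a (Suc k) \<le> (1 - c) * a k + \<alpha> * b k"
    and b: "\<And>k. b (Suc k) \<le> (1 - c) * b k + g * (a k + \<alpha> * b k + p * (e k + a k))"
    and nonneg: "0 \<le> p" "0 \<le> \<alpha>" "0 \<le> g" and c: "c \<le> 1" "t / 4 \<le> c / 2" and t: "t \<le> 2"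
    and A: "A > 0" "p * A \<le> t / 4" and D: "D > 0" "\<alpha> * D \<le> c / 2 * A"
    and g: "g * (A + \<alpha> * D + p * (1 + A)) \<le> c / 2 * D"
  shows "\<exists>K. \<forall>k. e k + a k \<le> K * (1 - t / 4) ^ k"
proof -
  \<comment> \<open>Each initial value is divided by its weight, so that the weighted bound holds at
    the start.\<close>
  define K where "K = \<bar>e 0\<bar> + \<bar>a 0\<bar> / A + \<bar>b 0\<bar> / D"
  have K: "K \<ge> 0" "\<bar>e 0\<bar> \<le> K" "\<bar>a 0\<bar> / A \<le> K" "\<bar>b 0\<bar> / D \<le> K"
    using A(1) D(1) by (auto simp: K_def)
  have *: "e k \<le> K * (1 - t / 4) ^ k \<and> a k \<le> A * (K * (1 - t / 4) ^ k)
      \<and> b k \<le> D * (K * (1 - t / 4) ^ k)" for k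
  proof (induction k)
    case 0
    have "\<bar>a 0\<bar> \<le> A * K" "\<bar>b 0\<bar> \<le> D * K" using K(3,4) A(1) D(1) by (simp_all add: field_simps)
    then show ?case using K(2) by auto
  next
    case (Suc k)
    define s where "s = K * (1 - t / 4) ^ k"
    have s: "s \<ge> 0" using K(1) t by (simp add: s_def)
    from Suc have IH: "e k \<le> s" "a k \<le> A * s" "b k \<le> D * s" by (auto simp: s_def)
    \<comment> \<open>In each of the three recursions half of the contraction margin pays for the
      coupling: t/2 drops to t/4, and c to c/2, which is still at least t/4.\<close>
    have "e (Suc k) \<le> (1 - t / 2) * s + p * (A * s)"
      using e[of k] mult_left_mono[OF IH(1), of "1 - t / 2"] mult_left_mono[OF IH(2) nonneg(1)] t
      by linarith
    also have "\<dots> \<le> (1 - t / 4) * s"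
      using mult_right_mono[OF A(2) s] by (simp add: algebra_simps)
    finally have e': "e (Suc k) \<le> (1 - t / 4) * s" .
    have "a (Suc k) \<le> (1 - c) * (A * s) + \<alpha> * (D * s)"
      using a[of k] mult_left_mono[OF IH(2), of "1 - c"] mult_left_mono[OF IH(3) nonneg(2)] c
      by linarith
    also have "\<dots> \<le> (1 - c / 2) * (A * s)"
      using mult_right_mono[OF D(2) s] by (simp add: algebra_simps)
    also have "\<dots> \<le> (1 - t / 4) * (A * s)"
      using c A(1) s by (intro mult_right_mono) auto
    finally have a': "a (Suc k) \<le> A * ((1 - t / 4) * s)" by (simp add: algebra_simps)
    have "a k + \<alpha> * b k + p * (e k + a k) \<le> A * s + \<alpha> * (D * s) + p * (s + A * s)"
      using IH nonneg by (intro add_mono mult_left_mono) auto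
    then have "g * (a k + \<alpha> * b k + p * (e k + a k)) \<le> g * (A * s + \<alpha> * (D * s) + p * (s + A * s))"
      using nonneg by (intro mult_left_mono)
    also have "\<dots> = g * (A + \<alpha> * D + p * (1 + A)) * s" by (simp add: algebra_simps)
    also have "\<dots> \<le> c / 2 * D * s" using mult_right_mono[OF g s] .
    finally have "b (Suc k) \<le> (1 - c) * (D * s) + c / 2 * D * s"
      using b[of k] mult_left_mono[OF IH(3), of "1 - c"] c by linarith
    also have "\<dots> = (1 - c / 2) * (D * s)" by (simp add: algebra_simps)
    also have "\<dots> \<le> (1 - t / 4) * (D * s)"
      using c D(1) s by (intro mult_right_mono) auto
    finally have "b (Suc k) \<le> D * ((1 - t / 4) * s)" by (simp add: algebra_simps)
    then show ?case using e' a' by (simp add: s_def mult_ac)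
  qed
  have "e k + a k \<le> (1 + A) * K * (1 - t / 4) ^ k" for k
    using *[of k] by (simp add: algebra_simps)
  then show ?thesis by blast
qed

section \<open>Diagonal matrices, entrywise maxima and sums of rows\<close>

lemma matrix_inv_diag_matrix:
  fixes v :: "real ^ 'n::finite"
  assumes "\<And>i. v $ i \<noteq> 0"
  shows "matrix_inv (diag_matrix v) = diag_matrix (\<chi> i. 1 / v $ i)"
proof -
  have 1: "diag_matrix v ** diag_matrix (\<chi> i. 1 / v $ i) = mat 1"
    using assms by (auto simp: vec_eq_iff matrix_matrix_mult_def diag_matrix_def mat_def
        if_distrib[of "\<lambda>x. x * _"] cong: if_cong)
  then have 2: "diag_matrix (\<chi> i. 1 / v $ i) ** diag_matrix v = mat 1"
    by (rule matrix_left_right_inverse[THEN iffD1])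
  \<comment> \<open>\<open>matrix_inv\<close> is a chosen two-sided inverse: the exhibited one shows
    that the choice succeeds, and cancellation shows that the two agree.\<close>
  have "matrix_inv (diag_matrix v) ** diag_matrix v = mat 1"
    unfolding matrix_inv_def
    by (rule someI2[where a = "diag_matrix (\<chi> i. 1 / v $ i)"]) (use 1 2 in auto)
  then have "matrix_inv (diag_matrix v) ** (diag_matrix v ** diag_matrix (\<chi> i. 1 / v $ i))
      = diag_matrix (\<chi> i. 1 / v $ i)"
    by (simp add: matrix_mul_assoc)
  then show ?thesis by (simp add: 1)
qed

lemma diag_matrix_mult_row:
  fixes z :: "real ^ 'p ^ 'n::finite"
  shows "(diag_matrix d ** z) $ i = d $ i *\<^sub>R z $ i"
proof -
  have "(diag_matrix d ** z) $ i = (\<Sum>j\<in>UNIV. if i = j then d $ i *\<^sub>R z $ j else 0)"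
    unfolding matrix_mult_row by (rule sum.cong) (auto simp: diag_matrix_def)
  then show ?thesis by simp
qed

lemma abs_entry_le_max_abs_entry: "\<bar>M $ i $ j\<bar> \<le> max_abs_entry M"
proof -
  have "{\<bar>M $ i $ j\<bar> | i j. True} = (\<lambda>(i, j). \<bar>M $ i $ j\<bar>) ` UNIV" by auto
  then show ?thesis unfolding max_abs_entry_def by (intro Max_ge) auto
qed

lemma max_abs_entry_le:
  assumes "\<And>i j. \<bar>M $ i $ j\<bar> \<le> d"
  shows "max_abs_entry M \<le> d"
proof -
  have "{\<bar>M $ i $ j\<bar> | i j. True} = (\<lambda>(i, j). \<bar>M $ i $ j\<bar>) ` UNIV" by auto
  then show ?thesis unfolding max_abs_entry_def using assms by (intro Max.boundedI) auto
qed

lemma norm_mean_le: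
  fixes z :: "'i::finite \<Rightarrow> 'a::real_normed_vector"
  assumes "\<And>i. norm (z i) \<le> d"
  shows "norm ((1 / real CARD('i)) *\<^sub>R (\<Sum>i\<in>UNIV. z i)) \<le> d"
proof -
  have "norm (\<Sum>i\<in>UNIV. z i) \<le> real CARD('i) * d"
    using sum_norm_le[of UNIV z "\<lambda>_. d"] assms by simp
  then show ?thesis by (simp add: field_simps)
qed

lemma norm_le_sum_rows: "norm (z :: real ^ 'p ^ 'n::finite) \<le> (\<Sum>i\<in>UNIV. norm (z $ i))"
  unfolding norm_vec_def by (rule L2_set_le_sum) simp

lemma column_stochastic_sum_rows:
  fixes z :: "real ^ 'p ^ 'n::finite"
  assumes "\<And>j. (\<Sum>i\<in>UNIV. C $ i $ j) = 1"
  shows "(\<Sum>i\<in>UNIV. (C ** z) $ i) = (\<Sum>i\<in>UNIV. z $ i)"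
proof -
  have "(\<Sum>i\<in>UNIV. (C ** z) $ i) = (\<Sum>j\<in>UNIV. \<Sum>i\<in>UNIV. C $ i $ j *\<^sub>R z $ j)"
    unfolding matrix_mult_row by (rule sum.swap)
  then show ?thesis using assms by (simp flip: scaleR_sum_left)
qed

lemma normalized_matrix_mult_row:
  fixes z w :: "real ^ 'p ^ 'n::finite"
  assumes "\<And>i. v (Suc k) $ i \<noteq> 0" and "\<And>i. w $ i = v k $ i *\<^sub>R z $ i"
  shows "(normalized_matrix C v k ** z) $ i = (1 / v (Suc k) $ i) *\<^sub>R (C k ** w) $ i"
  using assms by (simp add: matrix_mult_row normalized_matrix_def scaleR_sum_right mult_ac)

text \<open>In the variables \<open>x\<close> and \<open>h = V\<inverse> y\<close> the algorithm is gradient tracking with the row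
  stochastic matrices \<open>V(k+1)\<inverse> C(k) V(k)\<close>, while the mean of \<open>u\<close> performs a perturbed gradient
  step on the average function.\<close>

lemma push_DIGing_decay:
  fixes f :: "'n::finite \<Rightarrow> real ^ 'p::finite \<Rightarrow> real" and A :: "nat \<Rightarrow> ('n \<times> 'n) set"
    and x u y :: "nat \<Rightarrow> real ^ 'p ^ 'n" and T :: nat
  defines "n \<equiv> real CARD('n)" and "M \<equiv> CARD('n) * T"
  defines "c \<equiv> (1 / n) ^ M / real M"
  assumes smooth: "\<And>i z w. norm (gradient (f i) z - gradient (f i) w) \<le> L * norm (z - w)"
    and G: "\<And>z. G z = (1 / n) *\<^sub>R (\<Sum>i\<in>UNIV. gradient (f i) z)"
    and contr: "\<And>z. norm (z - \<alpha> *\<^sub>R G z - x_star) \<le> (1 - \<alpha> * \<mu> / 2) * norm (z - x_star)"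
    and G0: "G x_star = 0"
    and L: "L > 0" and \<mu>: "\<mu> > 0" and \<alpha>: "\<alpha> > 0"
    and no_loops: "\<And>k i. (i, i) \<notin> A k"
    and T: "T > 0"
    and connected: "\<And>t. strongly_connected_arcs (\<Union>l\<in>{t * T .. (t + 1) * T - 1}. A l)"
    and algorithm: "push_DIGing f (\<lambda>k. mixing_matrix (A k)) \<alpha> u v V x y"
    and W: "\<And>k i. 1 / v k $ i \<le> W"
    and \<alpha>L: "2 * \<alpha> * L \<le> 1" and \<alpha>\<mu>: "\<alpha> * \<mu> \<le> 2 * c"
    and gain: "\<alpha> * L * (2 * real M * W) * (3 + 4 * (L / \<mu>) * (\<alpha> * L)) \<le> c\<^sup>2 / 4"
  shows "\<exists>K. \<forall>k. norm (x k - (\<chi> i. x_star)) \<le> K * (1 - \<alpha> * \<mu> / 4) ^ k"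
proof -
  let ?C = "\<lambda>k. mixing_matrix (A k)"
  have n: "n \<ge> 1" by (simp add: n_def Suc_le_eq)
  have M: "M > 0" using T by (simp add: M_def)
  have nM: "(1 / n) ^ M \<le> 1" "(1 / n) ^ M > 0" using n by (auto intro: power_le_one)
  have c: "c > 0" "c \<le> 1"
  proof -
    show "c > 0" using nM M by (simp add: c_def)
    have "(1 / n) ^ M / real M \<le> 1 / 1" using nM M by (intro frac_le) auto
    then show "c \<le> 1" by (simp add: c_def)
  qed
  have u0: "u 0 = x 0" and y0: "y 0 = gradient_rows f (x 0)" and v0: "v 0 = (\<chi> i. 1)"
    and V0: "V 0 = diag_matrix (v 0)"
    and uS: "u (Suc k) = ?C k ** (u k - \<alpha> *\<^sub>R y k)"
    and vS: "v (Suc k) = ?C k *v v k" and VS: "V (Suc k) = diag_matrix (v (Suc k))"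
    and xS: "x (Suc k) = matrix_inv (V (Suc k)) ** u (Suc k)"
    and yS: "y (Suc k) = ?C k ** y k + gradient_rows f (x (Suc k)) - gradient_rows f (x k)" for k
    using algorithm by (auto simp: push_DIGing_def)
  have col: "(\<Sum>i\<in>UNIV. ?C k $ i $ j) = 1" for k j
    by (rule mixing_matrix_column_sum[OF no_loops])
  have v_pos: "v k $ i > 0" for k i
    using push_sum_ge[OF no_loops T connected v0 vS, of k i] nM(2)
    unfolding n_def M_def by linarith
  have v_ne: "v k $ i \<noteq> 0" for k i using v_pos[of k i] by simp
  have v_sum: "(\<Sum>i\<in>UNIV. v k $ i) = n" for k
    unfolding n_def by (rule push_sum_sum[OF col v0 vS])
  define R where "R = normalized_matrix ?C v"
  have R: "row_stochastic (R k)" for k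
    unfolding R_def by (rule row_stochastic_normalized_matrix[of v ?C, OF v_pos mixing_matrix_nonneg vS])
  have R_contr: "spread (backward_product R k M ** z) \<le> (1 - (1 / n) ^ M) * spread z"
    for k and z :: "real ^ 'p ^ 'n"
    unfolding R_def
    by (rule spread_normalized_product[of v ?C, OF v_pos mixing_matrix_nonneg vS])
       (use v_sum nM mixing_product_ge[OF no_loops T connected] in \<open>auto simp: n_def M_def\<close>)
  have step: "window_spread R M (Suc k) (R k ** z) \<le> (1 - c) * window_spread R M k z"
    for k and z :: "real ^ 'p ^ 'n"
    unfolding c_def by (rule window_spread_step[OF R M _ R_contr]) (use nM in auto)

  have u_row: "u k $ i = v k $ i *\<^sub>R x k $ i" for k i
  proof (cases k)
    case (Suc l)
    then show ?thesis
      by (simp add: xS[of l] VS matrix_inv_diag_matrix[OF v_ne] diag_matrix_mult_row v_ne)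
  qed (simp add: u0 v0)
  define h where "h k = (\<chi> i. (1 / v k $ i) *\<^sub>R y k $ i)" for k
  have y_row: "y k $ i = v k $ i *\<^sub>R h k $ i" for k i by (simp add: h_def v_ne)
  have x_step: "x (Suc k) = R k ** (x k - \<alpha> *\<^sub>R h k)" for k
  proof -
    have "x (Suc k) $ i = (R k ** (x k - \<alpha> *\<^sub>R h k)) $ i" for i
      unfolding R_def
      by (subst normalized_matrix_mult_row[where w = "u k - \<alpha> *\<^sub>R y k"])
         (simp_all add: v_ne u_row y_row algebra_simps flip: uS)
    then show ?thesis by (simp add: vec_eq_iff)
  qed
  define g where "g k = (\<chi> i. (1 / v (Suc k) $ i) *\<^sub>R
      (gradient (f i) (x (Suc k) $ i) - gradient (f i) (x k $ i)))" for k
  have h_step: "h (Suc k) = R k ** h k + g k" for k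
  proof -
    have "h (Suc k) $ i = (R k ** h k + g k) $ i" for i
      unfolding R_def vector_add_component
      by (subst normalized_matrix_mult_row[where w = "y k"])
         (simp_all add: v_ne y_row[symmetric] h_def[of "Suc k"] g_def yS gradient_rows_def algebra_simps)
    then show ?thesis by (simp add: vec_eq_iff)
  qed
  \<comment> \<open>By \<open>u_row\<close> and \<open>y_row\<close> these are the means of the rows
    of \<open>x\<close> and \<open>h\<close> with weights \<open>v k\<close> / n, hence convex
    combinations of those rows.\<close>
  define ub where "ub k = (1 / n) *\<^sub>R (\<Sum>i\<in>UNIV. u k $ i)" for k
  define yb where "yb k = (1 / n) *\<^sub>R (\<Sum>i\<in>UNIV. y k $ i)" for k
  \<comment> \<open>Tracking: mixing preserves the sum of the rows of \<open>y\<close>, and the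
    added gradient differences telescope from \<open>y 0\<close>.\<close>
  have y_sum: "(\<Sum>i\<in>UNIV. y k $ i) = (\<Sum>i\<in>UNIV. gradient (f i) (x k $ i))" for k
  proof (induction k)
    case (Suc k)
    then show ?case
      by (simp add: yS sum.distrib sum_subtractf column_stochastic_sum_rows[OF col] gradient_rows_def)
  qed (simp add: y0 gradient_rows_def)
  have ub_step: "ub (Suc k) = ub k - \<alpha> *\<^sub>R yb k" for k
    unfolding ub_def yb_def uS column_stochastic_sum_rows[OF col]
    by (simp add: sum_subtractf scaleR_diff_right mult_ac flip: scaleR_sum_right)
  have mean_near: "norm ((1 / n) *\<^sub>R (\<Sum>j\<in>UNIV. v k $ j *\<^sub>R z $ j) - z $ i) \<le> spread z"
    for k i and z :: "real ^ 'p ^ 'n"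
  proof -
    have "norm ((\<Sum>j\<in>UNIV. (v k $ j / n) *\<^sub>R z $ j) - z $ i) \<le> spread z"
      by (rule norm_convex_combination_diff_le)
         (use v_pos n v_sum norm_row_diff_le_spread in \<open>auto simp: less_imp_le simp flip: sum_divide_distrib\<close>)
    then show ?thesis by (simp add: scaleR_sum_right)
  qed

  define a where "a k = window_spread R M k (x k)" for k
  define b where "b k = window_spread R M k (h k)" for k
  define e where "e k = norm (ub k - x_star)" for k
  have spread_a: "spread (x k) \<le> a k" and spread_b: "spread (h k) \<le> b k" for k
    unfolding a_def b_def by (rule spread_le_window_spread[OF M])+
  have x_ub: "norm (x k $ i - ub k) \<le> a k" for k i
    using mean_near[where z = "x k" and k = k and i = i] spread_a[of k]
    by (simp add: ub_def u_row norm_minus_commute)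
  have x_near: "norm (x k $ i - x_star) \<le> e k + a k" for k i
    using norm_triangle_ineq[of "x k $ i - ub k" "ub k - x_star"] x_ub[of k i] by (simp add: e_def)
  have yb_mean: "yb k = (1 / n) *\<^sub>R (\<Sum>i\<in>UNIV. gradient (f i) (x k $ i))" for k
    by (simp add: yb_def y_sum)
  \<comment> \<open>Serves at two points: at \<open>ub k\<close> it bounds the bias of the gradient
    step, at \<open>x_star\<close>, where \<open>G\<close> vanishes, the size of
    \<open>yb k\<close>.\<close>
  have yb_le: "norm (yb k - G z) \<le> d"
    if "\<And>i. L * norm (x k $ i - z) \<le> d" for k z d
  proof -
    have "yb k - G z = (1 / n) *\<^sub>R (\<Sum>i\<in>UNIV. gradient (f i) (x k $ i) - gradient (f i) z)"
      by (simp add: yb_mean G sum_subtractf scaleR_diff_right)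
    also have "norm \<dots> \<le> d"
      unfolding n_def by (rule norm_mean_le) (use smooth that order_trans in blast)
    finally show ?thesis .
  qed
  have e_rec: "e (Suc k) \<le> (1 - \<alpha> * \<mu> / 2) * e k + \<alpha> * L * a k" for k
  proof -
    have *: "ub (Suc k) - x_star = (ub k - \<alpha> *\<^sub>R G (ub k) - x_star) - \<alpha> *\<^sub>R (yb k - G (ub k))"
      by (simp add: ub_step algebra_simps)
    have "e (Suc k) \<le> norm (ub k - \<alpha> *\<^sub>R G (ub k) - x_star) + \<alpha> * norm (yb k - G (ub k))"
      using norm_triangle_ineq4[of "ub k - \<alpha> *\<^sub>R G (ub k) - x_star" "\<alpha> *\<^sub>R (yb k - G (ub k))"] \<alpha>
      unfolding e_def * by simp
    also have "\<dots> \<le> (1 - \<alpha> * \<mu> / 2) * e k + \<alpha> * (L * a k)"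
      using contr[of "ub k"] yb_le[of k "ub k" "L * a k"] x_ub L \<alpha>
      by (intro add_mono mult_left_mono) (auto simp: e_def)
    finally show ?thesis by (simp add: mult_ac)
  qed
  have a_rec: "a (Suc k) \<le> (1 - c) * a k + \<alpha> * b k" for k
  proof -
    have "a (Suc k) \<le> (1 - c) * window_spread R M k (x k + (- \<alpha>) *\<^sub>R h k)"
      using step[of k "x k - \<alpha> *\<^sub>R h k"] by (simp add: a_def x_step)
    also have "window_spread R M k (x k + (- \<alpha>) *\<^sub>R h k) \<le> a k + \<alpha> * b k"
      using window_spread_add[of R M k "x k" "(- \<alpha>) *\<^sub>R h k"]
        window_spread_scaleR[of R M k "- \<alpha>" "h k"] \<alpha> by (simp add: a_def b_def)
    also have "(1 - c) * (a k + \<alpha> * b k) \<le> (1 - c) * a k + \<alpha> * b k"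
      using c \<alpha> window_spread_nonneg[of R M k "h k"] by (simp add: b_def algebra_simps)
    finally show ?thesis using c by (simp add: mult_left_mono)
  qed
  \<comment> \<open>Each row of \<open>x (Suc k)\<close> is a convex combination of the rows of
    \<open>x k - \<alpha> *\<^sub>R h k\<close>, so it suffices to compare all of these with row
    \<open>i\<close> of \<open>x k\<close>; the rows of \<open>h k\<close> lie within
    \<open>b k\<close> of \<open>yb k\<close>.\<close>
  have x_move: "norm (x (Suc k) $ i - x k $ i) \<le> a k + \<alpha> * b k + \<alpha> * L * (e k + a k)" for k i
  proof -
    have "norm (yb k) \<le> L * (e k + a k)"
      using yb_le[of k x_star "L * (e k + a k)"] x_near L G0 by simp
    then have "norm (h k $ j) \<le> b k + L * (e k + a k)" for j
      using mean_near[of k "h k" j] spread_b[of k] norm_triangle_ineq4[of "yb k" "yb k - h k $ j"]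
      by (simp add: yb_def y_row)
    then have "\<alpha> * norm (h k $ j) \<le> \<alpha> * (b k + L * (e k + a k))" for j
      using \<alpha> by (intro mult_left_mono) auto
    then have "norm ((x k - \<alpha> *\<^sub>R h k) $ j - x k $ i) \<le> a k + \<alpha> * b k + \<alpha> * L * (e k + a k)" for j
    proof -
      have "(x k - \<alpha> *\<^sub>R h k) $ j - x k $ i = (x k $ j - x k $ i) - \<alpha> *\<^sub>R h k $ j" by simp
      also have "norm \<dots> \<le> norm (x k $ j - x k $ i) + \<alpha> * norm (h k $ j)"
        using norm_triangle_ineq4[of "x k $ j - x k $ i" "\<alpha> *\<^sub>R h k $ j"] \<alpha> by simp
      also have "\<dots> \<le> a k + \<alpha> * (b k + L * (e k + a k))"
        by (intro add_mono order_trans[OF norm_row_diff_le_spread spread_a])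
          (use \<open>\<And>j. \<alpha> * norm (h k $ j) \<le> \<alpha> * (b k + L * (e k + a k))\<close> in auto)
      finally show ?thesis by (simp add: algebra_simps)
    qed
    then show ?thesis
      unfolding x_step[of k] matrix_mult_row
      by (intro norm_convex_combination_diff_le) (use R in \<open>auto simp: row_stochastic_def\<close>)
  qed
  have W_pos: "W > 0"
    using W[of 0 undefined] v_pos[of 0 undefined] by (smt (verit) zero_less_divide_1_iff)
  have b_rec: "b (Suc k) \<le> (1 - c) * b k
      + 2 * real M * W * L * (a k + \<alpha> * b k + \<alpha> * L * (e k + a k))" for k
  proof -
    let ?d = "a k + \<alpha> * b k + \<alpha> * L * (e k + a k)"
    have "norm (g k $ i) \<le> W * (L * ?d)" for i
    proof -
      have "norm (g k $ i) = 1 / v (Suc k) $ i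
          * norm (gradient (f i) (x (Suc k) $ i) - gradient (f i) (x k $ i))"
        using v_pos[of "Suc k" i] by (simp add: g_def)
      also have "\<dots> \<le> W * (L * ?d)"
        using W_pos L by (intro mult_mono W order_trans[OF smooth mult_left_mono[OF x_move]]) auto
      finally show ?thesis .
    qed
    then have "real M * spread (g k) \<le> real M * (2 * (W * (L * ?d)))"
      by (intro mult_left_mono spread_le_norm) auto
    then have "window_spread R M (Suc k) (g k) \<le> 2 * real M * W * L * ?d"
      using window_spread_le[of R M "Suc k" "g k", OF R] by (simp add: mult_ac)
    then show ?thesis
      using window_spread_add[of R M "Suc k" "R k ** h k" "g k"] step[of k "h k"]
      by (simp add: b_def h_step)
  qed

  \<comment> \<open>Weights of the two spreads relative to \<open>e\<close>, as large as their first
    constraints permit: \<alpha> L q = \<alpha> \<mu> / 4 and \<alpha> D = c q / 2.\<close>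
  define q where "q = \<mu> / (4 * L)"
  define D where "D = c * q / (2 * \<alpha>)"
  have q: "q > 0" using L \<mu> by (simp add: q_def)
  have "\<exists>K. \<forall>k. e k + a k \<le> K * (1 - \<alpha> * \<mu> / 4) ^ k"
  proof (rule coupled_recursion_decay[where e = e and a = a and b = b, OF e_rec a_rec b_rec])
    show "\<alpha> * L * q \<le> \<alpha> * \<mu> / 4" using L by (simp add: q_def)
    show "D > 0" using q c \<alpha> by (simp add: D_def)
    show "\<alpha> * D \<le> c / 2 * q" using \<alpha> by (simp add: D_def)
    \<comment> \<open>The left side is (q + \<alpha> D + \<alpha> L (1 + q)) / q, its last term
      being \<alpha> L / q. The other three terms add up to at most 2.\<close>
    have "1 + c / 2 + \<alpha> * L + 4 * (L / \<mu>) * (\<alpha> * L) \<le> 3 + 4 * (L / \<mu>) * (\<alpha> * L)"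
      using c \<alpha>L by auto
    then have "\<alpha> * L * (2 * real M * W) * (1 + c / 2 + \<alpha> * L + 4 * (L / \<mu>) * (\<alpha> * L)) \<le> c\<^sup>2 / 4"
      using \<alpha> L W_pos by (intro order_trans[OF mult_left_mono gain]) auto
    then have "\<alpha> * L * (2 * real M * W) * (1 + c / 2 + \<alpha> * L + 4 * (L / \<mu>) * (\<alpha> * L)) * (q / \<alpha>)
        \<le> c\<^sup>2 / 4 * (q / \<alpha>)"
      using q \<alpha> by (intro mult_right_mono) auto
    moreover have "2 * real M * W * L * (q + \<alpha> * D + \<alpha> * L * (1 + q))
        = \<alpha> * L * (2 * real M * W) * (1 + c / 2 + \<alpha> * L + 4 * (L / \<mu>) * (\<alpha> * L)) * (q / \<alpha>)"
      using \<alpha> L \<mu> by (simp add: D_def q_def field_simps)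
    moreover have "c\<^sup>2 / 4 * (q / \<alpha>) = c / 2 * D"
      by (simp add: D_def power2_eq_square)
    ultimately show "2 * real M * W * L * (q + \<alpha> * D + \<alpha> * L * (1 + q)) \<le> c / 2 * D"
      by linarith
  qed (use \<alpha> L c \<alpha>\<mu> q W_pos in auto)
  then obtain K where K: "\<And>k. e k + a k \<le> K * (1 - \<alpha> * \<mu> / 4) ^ k" by blast
  have "norm (x k - (\<chi> i. x_star)) \<le> n * K * (1 - \<alpha> * \<mu> / 4) ^ k" for k
  proof -
    have "norm (x k - (\<chi> i. x_star)) \<le> (\<Sum>i\<in>UNIV. norm (x k $ i - x_star))"
      using norm_le_sum_rows[of "x k - (\<chi> i. x_star)"] by simp
    also have "\<dots> \<le> n * (K * (1 - \<alpha> * \<mu> / 4) ^ k)"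
      unfolding n_def by (rule sum_bounded_above) (use x_near K order_trans in blast)
    finally show ?thesis by (simp add: mult_ac)
  qed
  then show ?thesis by blast
qed

subsection \<open>The constants\<close>

text \<open>With w = n^((2 + n Bo) n Bo) the power of \<open>tau_tilde\<close> is 1/w, so Q1 = 2 n
  (1 + w) / (1 - 1/w) is at least 2 n w.\<close>

lemma Q1_const_ge:
  assumes "n \<ge> 2" "Bo > 0"
  shows "4 * real n ^ ((2 + n * Bo) * (n * Bo)) \<le> Q1_const n Bo"
proof -
  define w where "w = real n ^ ((2 + n * Bo) * (n * Bo))"
  have tau: "tau_tilde n Bo ^ (n * Bo) = 1 / w"
    by (simp only: tau_tilde_def w_def power_one_over power_mult)
  have w: "w > 1"
    unfolding w_def by (rule one_less_power) (use assms in auto)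
  have "w * (1 - 1 / w) \<le> 1 + w" using w by (simp add: algebra_simps)
  then have "w \<le> (1 + w) / (1 - 1 / w)"
    using w by (simp add: pos_le_divide_eq)
  then have "4 * w \<le> 2 * real n * ((1 + w) / (1 - 1 / w))"
    using assms w by (intro mult_mono) auto
  then show ?thesis unfolding Q1_const_def tau w_def[symmetric] by simp
qed

lemma delta_const_nonneg:
  assumes "n \<ge> 2" "Bo > 0"
  shows "0 \<le> delta_const n Bo B"
proof -
  have "0 \<le> 4 * real n ^ ((2 + n * Bo) * (n * Bo))" by simp
  then have "0 \<le> Q1_const n Bo" using Q1_const_ge[OF assms] by linarith
  then show ?thesis by (simp add: delta_const_def)
qed

text \<open>For \<open>B\<close> at most 1 the exponent of \<open>powr\<close> is nonpositive over a
  base in (0, 1], so neither factor of delta is below 1.\<close>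

lemma delta_const_less_1_imp:
  assumes "n \<ge> 2" "Bo > 0" "delta_const n Bo B < 1"
  shows "B \<ge> 2"
proof (rule ccontr)
  assume "\<not> B \<ge> 2"
  define w where "w = real n ^ ((2 + n * Bo) * (n * Bo))"
  define q where "q = 1 - 1 / w"
  have w: "w > 1"
    unfolding w_def by (rule one_less_power) (use assms in auto)
  then have q: "0 < q" "q \<le> 1" by (auto simp: q_def)
  have "(real B - 1) / real (n * Bo) \<le> 0"
    using \<open>\<not> B \<ge> 2\<close> by (intro divide_nonpos_nonneg) auto
  then have "1 \<le> q powr ((real B - 1) / real (n * Bo))"
    using powr_mono'[of "(real B - 1) / real (n * Bo)" 0 q] q by simp
  moreover have "1 \<le> Q1_const n Bo" using Q1_const_ge[OF assms(1,2)] w unfolding w_def by linarith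
  ultimately have "1 * 1 \<le> delta_const n Bo B"
    unfolding delta_const_def w_def[symmetric] q_def[symmetric] by (intro mult_mono) auto
  then show False using assms by simp
qed

text \<open>84 is 1.5 * 56, the 1.5 from \<open>alpha_max\<close> and the 56 from the loop gain.
  Bounding B, 1 + sqrt n and the last factor below by 2, 2 and 4 sqrt kappa leaves 48 Q1^2 W
  kappa^(3/2), and the powers of n in Q1^2 cover M^3 n^(2 M).\<close>

lemma J2_const_ge:
  assumes n: "n \<ge> 2" and T: "T > 0" "Bo = 2 * T - 1" and \<delta>: "delta_const n Bo B < 1"
    and \<kappa>: "\<kappa> \<ge> 1" and W: "W \<ge> 1" and M: "M = n * T"
  shows "84 * real M ^ 3 * real n ^ (2 * M) * W * (\<kappa> * sqrt \<kappa>) \<le> J2_const n Bo B \<kappa> W"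
proof -
  have Bo: "Bo > 0" "T \<le> Bo" using T by auto
  have B: "B \<ge> 2" by (rule delta_const_less_1_imp[OF n Bo(1) \<delta>])
  have d0: "0 \<le> delta_const n Bo B" by (rule delta_const_nonneg[OF n Bo(1)])
  define Q where "Q = Q1_const n Bo"
  \<comment> \<open>From \<open>Bo\<close> = 2 T - 1 \<ge> T it follows that M \<le> n Bo; the other
    factor is at least 4.\<close>
  have "4 * M \<le> (2 + n * Bo) * (n * Bo)"
  proof -
    have "2 \<le> n * Bo" using n Bo by (cases Bo) auto
    moreover have "M \<le> n * Bo" using Bo by (simp add: M)
    ultimately show ?thesis by (intro mult_mono) auto
  qed
  then have "real n ^ (4 * M) \<le> real n ^ ((2 + n * Bo) * (n * Bo))"
    using n by (intro power_increasing) auto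
  then have Q: "4 * real n ^ (4 * M) \<le> Q" using Q1_const_ge[OF n Bo(1)] by (simp add: Q_def)
  have n1: "1 \<le> real n ^ m" for m using n by (intro one_le_power) auto
  have Q1: "Q \<ge> 1" using Q n1[of "4 * M"] by linarith
  have "real M \<le> real n ^ M"
  proof -
    have "M < 2 ^ M" by (rule less_exp)
    also have "(2::nat) ^ M \<le> n ^ M" using n by (rule power_mono) simp
    finally show ?thesis by (metis of_nat_le_iff of_nat_power less_imp_le)
  qed
  then have "real M ^ 3 * real n ^ (2 * M) \<le> (real n ^ M) ^ 3 * real n ^ (2 * M)"
    by (intro mult_right_mono power_mono) auto
  also have "\<dots> = real n ^ (5 * M)" by (simp flip: power_mult power_add)
  also have "\<dots> \<le> real n ^ (8 * M)" using n by (intro power_increasing) auto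
  also have "\<dots> = (real n ^ (4 * M))\<^sup>2" by (simp flip: power_mult)
  also have "16 * \<dots> \<le> Q\<^sup>2"
    using power_mono[OF Q, of 2] by (simp add: power_mult_distrib)
  finally have MQ: "84 * (real M ^ 3 * real n ^ (2 * M)) \<le> 48 * Q\<^sup>2"
    using zero_le_power2[of Q] by linarith
  have sn: "1 \<le> sqrt (real n)" using n by simp
  have "84 * (real M ^ 3 * real n ^ (2 * M)) * (W * (\<kappa> * sqrt \<kappa>)) \<le> 48 * Q\<^sup>2 * (W * (\<kappa> * sqrt \<kappa>))"
    using MQ W \<kappa> by (intro mult_right_mono) auto
  also have "\<dots> = 3 * Q * W * \<kappa> * 2 * (Q * 1) * 2 * (4 * 1 * sqrt \<kappa>)"
    by (simp add: power2_eq_square)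
  also have "\<dots> \<le> 3 * Q * W * \<kappa> * real B * (delta_const n Bo B + Q * (real B - 1)) *
       (1 + sqrt (real n)) * (1 + 4 * sqrt (real n) * sqrt \<kappa>)"
  proof (intro mult_mono)
    have "Q * 1 \<le> Q * (real B - 1)" using Q1 B by (intro mult_left_mono) auto
    then show "Q * 1 \<le> delta_const n Bo B + Q * (real B - 1)" using d0 by simp
    have "4 * 1 * sqrt \<kappa> \<le> 4 * sqrt (real n) * sqrt \<kappa>"
      using sn \<kappa> by (intro mult_right_mono) auto
    then show "4 * 1 * sqrt \<kappa> \<le> 1 + 4 * sqrt (real n) * sqrt \<kappa>" by linarith
  qed (use Q1 W \<kappa> B sn d0 in \<open>auto intro!: add_nonneg_nonneg mult_nonneg_nonneg\<close>)
  finally show ?thesis by (simp add: J2_const_def Q_def mult_ac)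
qed

text \<open>At \<open>alpha_switch\<close> the two branches of \<open>rate\<close> agree; beyond it the second one is larger.\<close>

lemma beyond_alpha_switch:
  assumes \<mu>: "\<mu> > 0" and J: "J > 0" and \<delta>: "0 \<le> \<delta>" "\<delta> < 1" and \<alpha>: "alpha_switch \<mu> \<delta> J < \<alpha>" "\<alpha> > 0"
  shows "1 - \<alpha> * \<mu> / 1.5 \<le> (sqrt (\<alpha> * \<mu> * J / 1.5) + \<delta>)\<^sup>2"
proof -
  \<comment> \<open>In terms of \<open>w\<close> the claim reads 1 - w^2 / J \<le> (w + \<delta>)^2.
    Equality is a quadratic equation with positive root (S - \<delta> J) / (J + 1), and
    \<open>alpha_switch\<close> is the step-size at which \<open>w\<close> equals this root.\<close>
  define w where "w = sqrt (\<alpha> * \<mu> * J / 1.5)"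
  define S where "S = sqrt (J\<^sup>2 + (1 - \<delta>\<^sup>2) * J)"
  have w: "w \<ge> 0" "w\<^sup>2 = \<alpha> * \<mu> * J / 1.5" using \<mu> J \<alpha> by (auto simp: w_def)
  have d2: "\<delta>\<^sup>2 \<le> 1" using \<delta> by (simp add: power_le_one)
  have S: "S \<ge> 0" "S\<^sup>2 = J\<^sup>2 + (1 - \<delta>\<^sup>2) * J" using d2 J by (auto simp: S_def)
  have "(S - \<delta> * J)\<^sup>2 \<le> (w * (J + 1))\<^sup>2"
  proof -
    have "1.5 * (S - \<delta> * J)\<^sup>2 < \<alpha> * (\<mu> * J * (J + 1)\<^sup>2)"
      using \<alpha>(1) \<mu> J by (simp add: alpha_switch_def S_def pos_divide_less_eq)
    also have "\<dots> = 1.5 * (w * (J + 1))\<^sup>2" by (simp add: power_mult_distrib w(2))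
    finally show ?thesis by simp
  qed
  then have "S - \<delta> * J \<le> w * (J + 1)"
    by (rule power2_le_imp_le) (use w J in auto)
  then have "S\<^sup>2 \<le> (w * (J + 1) + \<delta> * J)\<^sup>2"
    using S(1) by (intro power_mono) auto
  then have "(J + 1) * J \<le> (J + 1) * (w\<^sup>2 * (J + 1) + 2 * w * \<delta> * J + \<delta>\<^sup>2 * J)"
    unfolding S(2) by (simp add: power2_eq_square algebra_simps)
  then have "J \<le> w\<^sup>2 * (J + 1) + 2 * w * \<delta> * J + \<delta>\<^sup>2 * J"
    using J by (simp only: mult_le_cancel_left_pos)
  also have "\<dots> = J * ((w + \<delta>)\<^sup>2 + \<alpha> * \<mu> / 1.5)"
    unfolding distrib_right w(2) power2_sum by (simp add: algebra_simps w(2))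
  finally have "J * 1 \<le> J * ((w + \<delta>)\<^sup>2 + \<alpha> * \<mu> / 1.5)" by simp
  then have "1 \<le> (w + \<delta>)\<^sup>2 + \<alpha> * \<mu> / 1.5" using J by (simp only: mult_le_cancel_left_pos)
  then show ?thesis by (simp add: w_def)
qed

text \<open>Both branches come down to (1 - t/4)^(2 B) \<le> 1 - t/1.5: the first is a root of the
  right side, and past the switch the square of the radicand dominates it.\<close>

lemma rate_ge:
  assumes \<mu>: "\<mu> > 0" and J: "J > 0" and \<delta>: "0 \<le> \<delta>" "\<delta> < 1" and \<alpha>: "\<alpha> > 0" "\<alpha> * \<mu> \<le> 1 / 2"
    and B: "B \<ge> 2"
  shows "1 - \<alpha> * \<mu> / 4 \<le> rate \<mu> \<delta> J B \<alpha>"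
proof -
  define t where "t = \<alpha> * \<mu>"
  have t: "t > 0" "t \<le> 1 / 2" using \<mu> \<alpha> by (auto simp: t_def)
  have "(1 - t / 4) ^ (2 * B) \<le> (1 - t / 4) ^ 4"
    using B t by (intro power_decreasing) auto
  also have "\<dots> \<le> 1 - t / 1.5"
  proof -
    \<comment> \<open>15/32 is 1/2 - 1/32: the term t^2 / 16 is at most t / 32 because t \<le>
      1/2.\<close>
    have 2: "(1 - t / 4)\<^sup>2 \<le> 1 - t * (15 / 32)"
      using mult_left_mono[OF t(2), of t] t by (simp add: power2_eq_square algebra_simps)
    have "((1 - t / 4)\<^sup>2)\<^sup>2 \<le> (1 - t * (15 / 32))\<^sup>2"
      using 2 by (intro power_mono) auto
    also have "\<dots> \<le> 1 - t / 1.5"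
      using mult_left_mono[OF t(2), of t] t by (simp add: power2_eq_square algebra_simps)
    finally show ?thesis by (simp flip: power_mult)
  qed
  finally have *: "(1 - t / 4) ^ (2 * B) \<le> 1 - t / 1.5" .
  show ?thesis
  proof (cases "\<alpha> \<le> alpha_switch \<mu> \<delta> J")
    case True
    have "root (2 * B) ((1 - t / 4) ^ (2 * B)) \<le> root (2 * B) (1 - t / 1.5)"
      using * B by simp
    moreover have "root (2 * B) ((1 - t / 4) ^ (2 * B)) = 1 - t / 4"
      using B t by (intro real_root_power_cancel) auto
    ultimately show ?thesis using True by (simp add: rate_def t_def)
  next
    case False
    let ?w = "sqrt (\<alpha> * \<mu> * J / 1.5) + \<delta>"
    have "((1 - t / 4) ^ B)\<^sup>2 \<le> ?w\<^sup>2"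
      using * beyond_alpha_switch[OF \<mu> J \<delta> _ \<alpha>(1)] False
      by (simp add: t_def mult.commute[of B] flip: power_mult)
    then have "(1 - t / 4) ^ B \<le> ?w"
      by (rule power2_le_imp_le) (use \<mu> J \<alpha> \<delta> in auto)
    then have "root B ((1 - t / 4) ^ B) \<le> root B ?w"
      using B by simp
    moreover have "root B ((1 - t / 4) ^ B) = 1 - t / 4"
      using B t by (intro real_root_power_cancel) auto
    ultimately show ?thesis using False by (simp add: rate_def t_def)
  qed
qed

section \<open>Verification of the loop-gain condition for the stated step-sizes\<close>

theorem theorem5p6:
  fixes f :: "'n::finite \<Rightarrow> real ^ 'p::finite \<Rightarrow> real"
    and L \<mu> :: "'n \<Rightarrow> real"
    and Lmax mu_bar kappa_bar :: real
    and x_star :: "real ^ 'p"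
    and A :: "nat \<Rightarrow> ('n \<times> 'n) set"
    and Bt Bo B :: nat
    and C :: "nat \<Rightarrow> real ^ 'n ^ 'n"
    and \<alpha> \<delta> J2 :: real
    and u x y :: "nat \<Rightarrow> real ^ 'p ^ 'n"
    and v :: "nat \<Rightarrow> real ^ 'n"
    and V :: "nat \<Rightarrow> real ^ 'n ^ 'n"
  assumes n_ge_2: "CARD('n) \<ge> 2"
    and differentiable: "\<And>i z. f i differentiable (at z)"
    and smooth: "\<And>i z w. norm (gradient (f i) z - gradient (f i) w) \<le> L i * norm (z - w)"
    and convex: "\<And>i z w. f i z \<ge> f i w + gradient (f i) w \<bullet> (z - w) + \<mu> i / 2 * (norm (z - w))\<^sup>2"
    and L_pos: "\<And>i. L i > 0"
    and mu_nonneg: "\<And>i. \<mu> i \<ge> 0"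
    and mu_pos: "\<exists>i. \<mu> i > 0"
    and Lmax: "Lmax = Max (range L)"
    and mu_bar: "mu_bar = (1 / real CARD('n)) * (\<Sum>i\<in>UNIV. \<mu> i)"
    and kappa_bar: "kappa_bar = Lmax / mu_bar"
    and x_star: "x_star = unique_minimizer (average_function f)"
    and no_loops: "\<And>k i. (i, i) \<notin> A k"
    and Bt_pos: "Bt > 0"
    and connected: "\<And>t. strongly_connected_arcs (\<Union>l\<in>{t * Bt .. (t + 1) * Bt - 1}. A l)"
    and Bo: "Bo = 2 * Bt - 1"
    and C: "\<And>k. C k = mixing_matrix (A k)"
    and delta: "\<delta> = delta_const CARD('n) Bo B"
    and delta_less_1: "\<delta> < 1"
    and algorithm: "push_DIGing f C \<alpha> u v V x y"
    and J2: "J2 = J2_const CARD('n) Bo B kappa_bar (SUP k. max_abs_entry (matrix_inv (V k)))"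
    and alpha_pos: "\<alpha> > 0"
    and alpha_le: "\<alpha> \<le> alpha_max mu_bar \<delta> J2"
  shows "x \<longlonglongrightarrow> (\<chi> i. x_star) \<and>
    (\<exists>K. \<forall>k. norm (x k - (\<chi> i. x_star)) \<le> K * rate mu_bar \<delta> J2 B \<alpha> ^ k)"
proof -
  have n: "CARD('n) \<ge> 2" by (rule n_ge_2)
  define M where "M = CARD('n) * Bt"
  define c where "c = (1 / real CARD('n)) ^ M / real M"
  define W where "W = (SUP k. max_abs_entry (matrix_inv (V k)))"
  define G where "G z = (1 / real CARD('n)) *\<^sub>R (\<Sum>i\<in>UNIV. gradient (f i) z)" for z
  let ?F = "average_function f"
  have M: "M > 0" using Bt_pos by (simp add: M_def)
  have C_eq: "C = (\<lambda>k. mixing_matrix (A k))" using C by auto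
  have Bo_pos: "Bo > 0" using Bo Bt_pos by simp
  have \<delta>: "0 \<le> \<delta>" unfolding delta by (rule delta_const_nonneg[OF n Bo_pos])
  have B: "B \<ge> 2"
    by (rule delta_const_less_1_imp[OF n Bo_pos]) (use delta delta_less_1 in simp)

  have V: "V k = diag_matrix (v k)" for k
    using algorithm by (cases k) (auto simp: push_DIGing_def)
  have v0: "v 0 = (\<chi> i. 1)" and vS: "v (Suc k) = mixing_matrix (A k) *v v k" for k
    using algorithm by (auto simp: push_DIGing_def C)
  have v_ge: "(1 / real CARD('n)) ^ M \<le> v k $ i" for k i
    unfolding M_def by (rule push_sum_ge[OF no_loops Bt_pos connected v0 vS])
  have nM: "(1 / real CARD('n)) ^ M > 0" by simp
  have v_pos: "v k $ i > 0" for k i using v_ge[of k i] nM by linarith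
  have Vinv: "matrix_inv (V k) = diag_matrix (\<chi> i. 1 / v k $ i)" for k
    unfolding V by (rule matrix_inv_diag_matrix) (use v_pos in \<open>auto simp: less_imp_neq[THEN not_sym]\<close>)
  \<comment> \<open>A real \<open>SUP\<close> dominates its family only if the family is bounded
    above; the lower bound on the push-sum weights provides that.\<close>
  have "max_abs_entry (matrix_inv (V k)) \<le> 1 / (1 / real CARD('n)) ^ M" for k
  proof (rule max_abs_entry_le)
    show "\<bar>matrix_inv (V k) $ i $ j\<bar> \<le> 1 / (1 / real CARD('n)) ^ M" for i j
      using v_pos[of k i] frac_le[OF _ _ nM v_ge[of k i], of 1 1] nM
      by (auto simp: Vinv diag_matrix_def simp del: power_one_over)
  qed
  then have bdd: "bdd_above (range (\<lambda>k. max_abs_entry (matrix_inv (V k))))"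
    by (intro bdd_aboveI2)
  have W: "1 / v k $ i \<le> W" for k i
  proof -
    have "1 / v k $ i \<le> max_abs_entry (matrix_inv (V k))"
      using abs_entry_le_max_abs_entry[of "matrix_inv (V k)" i i] v_pos[of k i]
      by (simp add: Vinv diag_matrix_def)
    also have "\<dots> \<le> W" unfolding W_def by (rule cSUP_upper[OF _ bdd]) simp
    finally show ?thesis .
  qed
  have W1: "W \<ge> 1" using W[of 0 undefined] by (simp add: v0)

  have L_le: "L i \<le> Lmax" for i unfolding Lmax by (rule Max_ge) auto
  have smooth': "norm (gradient (f i) z - gradient (f i) w) \<le> Lmax * norm (z - w)" for i z w
    by (rule order_trans[OF smooth mult_right_mono[OF L_le]]) simp
  have Lmax_pos: "Lmax > 0" using L_pos L_le by (metis less_le_trans)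
  have mu: "mu_bar > 0"
  proof -
    obtain i where "\<mu> i > 0" using mu_pos by auto
    then have "(\<Sum>i\<in>UNIV. \<mu> i) > 0" using mu_nonneg by (intro sum_pos2[of UNIV i]) auto
    then show ?thesis by (simp add: mu_bar)
  qed
  have derivF: "GDERIV ?F z :> G z" for z
  proof -
    have "((\<lambda>x. (1 / real CARD('n)) * (\<Sum>i\<in>UNIV. f i x)) has_derivative
        (\<lambda>h. (1 / real CARD('n)) * (\<Sum>i\<in>UNIV. h \<bullet> gradient (f i) z))) (at z)"
      by (intro has_derivative_mult_right has_derivative_sum)
         (use GDERIV_gradient[OF differentiable] in \<open>simp add: gderiv_def\<close>)
    moreover have "(\<lambda>h. (1 / real CARD('n)) * (\<Sum>i\<in>UNIV. h \<bullet> gradient (f i) z)) = (\<lambda>h. h \<bullet> G z)"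
      by (simp add: G_def inner_sum_right fun_eq_iff)
    ultimately show ?thesis by (simp add: gderiv_def average_function_def[abs_def])
  qed
  have convexF: "?F w + G w \<bullet> (z - w) + mu_bar / 2 * (norm (z - w))\<^sup>2 \<le> ?F z" for z w
  proof -
    have "(1 / real CARD('n)) * (\<Sum>i\<in>UNIV. f i w + gradient (f i) w \<bullet> (z - w)
        + \<mu> i / 2 * (norm (z - w))\<^sup>2) \<le> (1 / real CARD('n)) * (\<Sum>i\<in>UNIV. f i z)"
      by (intro mult_left_mono sum_mono convex) auto
    then show ?thesis
      by (simp add: average_function_def G_def mu_bar sum.distrib distrib_left inner_sum_left
          flip: sum_distrib_right sum_divide_distrib)
  qed
  have smoothF: "norm (G z - G w) \<le> Lmax * norm (z - w)" for z w
  proof -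
    have "G z - G w = (1 / real CARD('n)) *\<^sub>R (\<Sum>i\<in>UNIV. gradient (f i) z - gradient (f i) w)"
      by (simp add: G_def sum_subtractf scaleR_diff_right)
    then show ?thesis by (simp only: norm_mean_le[OF smooth'])
  qed
  have G0: "G x_star = 0"
    unfolding x_star by (rule gradient_unique_minimizer[OF derivF convexF mu])
  have "mu_bar \<le> Lmax" by (rule strong_convexity_le_Lipschitz[OF convexF smoothF])
  then have \<kappa>: "kappa_bar \<ge> 1" using mu by (simp add: kappa_bar)

  \<comment> \<open>A lower bound for J2 / (1.5 kappa^(3/2)). The 56 is 4 * 2 * 7: for the
    \<open>p\<close> below, \<open>p * J0 \<le> 1\<close> says precisely that 7 p * 2 M W \<le> c^2
    / 4.\<close>
  define J0 where "J0 = 56 * real M ^ 3 * real CARD('n) ^ (2 * M) * W"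
  have M3: "real M \<le> real M ^ 3" using M by (intro self_le_power) auto
  have nM1: "1 \<le> real CARD('n) ^ M" using n by (intro one_le_power) auto
  have nM2: "real CARD('n) ^ (2 * M) = real CARD('n) ^ M * real CARD('n) ^ M"
    by (simp add: mult_2 power_add)
  have J0_ge: "56 * (real M * real CARD('n) ^ M) \<le> J0"
  proof -
    have "real M * (real CARD('n) ^ M * 1) * 1 \<le> real M ^ 3 * (real CARD('n) ^ M * real CARD('n) ^ M) * W"
      by (intro mult_mono M3 W1 nM1) auto
    then show ?thesis by (simp add: J0_def nM2)
  qed
  have "1 * 1 \<le> real M * real CARD('n) ^ M" using M nM1 by (intro mult_mono) auto
  then have J0: "J0 \<ge> 56" using J0_ge by linarith
  have J2_ge: "1.5 * J0 * (kappa_bar * sqrt kappa_bar) \<le> J2"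
  proof -
    have "1.5 * J0 * (kappa_bar * sqrt kappa_bar)
        = 84 * real M ^ 3 * real CARD('n) ^ (2 * M) * W * (kappa_bar * sqrt kappa_bar)"
      by (simp add: J0_def)
    also have "\<dots> \<le> J2_const CARD('n) Bo B kappa_bar W"
      by (rule J2_const_ge[OF n Bt_pos Bo _ \<kappa> W1 M_def]) (use delta delta_less_1 in simp)
    finally show ?thesis by (simp only: J2 W_def)
  qed
  have sk: "sqrt kappa_bar \<ge> 1" using \<kappa> by simp
  have "0 < 1.5 * J0 * (kappa_bar * sqrt kappa_bar)" using J0 \<kappa> sk by auto
  then have J2_pos: "J2 > 0" using J2_ge by linarith

  have "\<alpha> * (mu_bar * J2) \<le> 1.5 * (1 - \<delta>)\<^sup>2"
    using alpha_le mu J2_pos by (simp add: alpha_max_def pos_le_divide_eq)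
  also have "(1 - \<delta>)\<^sup>2 \<le> 1" using \<delta> delta_less_1 by (intro power_le_one) auto
  finally have "\<alpha> * mu_bar * J2 \<le> 1.5" by simp
  moreover have "\<alpha> * mu_bar * (1.5 * J0 * (kappa_bar * sqrt kappa_bar)) \<le> \<alpha> * mu_bar * J2"
    using alpha_pos mu by (intro mult_left_mono J2_ge) auto
  moreover have "\<alpha> * mu_bar * (1.5 * J0 * (kappa_bar * sqrt kappa_bar))
      = 1.5 * (\<alpha> * Lmax * sqrt kappa_bar * J0)"
    using mu by (simp add: kappa_bar)
  ultimately have step_bound: "\<alpha> * Lmax * sqrt kappa_bar * J0 \<le> 1" by linarith
  define p where "p = \<alpha> * Lmax * sqrt kappa_bar"
  have "\<alpha> * Lmax > 0" using alpha_pos Lmax_pos by simp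
  then have p: "p > 0" "p * J0 \<le> 1" "\<alpha> * Lmax \<le> p"
    using step_bound \<kappa> mult_left_mono[OF sk, of "\<alpha> * Lmax"] by (auto simp: p_def)
  have p1: "p * 56 \<le> 1" using mult_left_mono[OF J0, of p] p by linarith
  have \<alpha>mu: "\<alpha> * mu_bar \<le> p"
    using \<open>mu_bar \<le> Lmax\<close> p(3) alpha_pos by (meson mult_left_mono less_imp_le order_trans)
  have c_eq: "c * (real M * real CARD('n) ^ M) = 1"
    using M n by (simp add: c_def power_one_over)
  have c_pos: "c > 0" using M n by (simp add: c_def)
  have "p * (56 * (real M * real CARD('n) ^ M)) \<le> 1"
    using mult_left_mono[OF J0_ge, of p] p by linarith
  then have "56 * p * (c * (real M * real CARD('n) ^ M)) \<le> c"
    using mult_left_mono[of _ 1 c] c_pos by (simp add: mult_ac)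
  then have pc: "56 * p \<le> c" by (simp add: c_eq)

  have "\<exists>K. \<forall>k. norm (x k - (\<chi> i. x_star)) \<le> K * (1 - \<alpha> * mu_bar / 4) ^ k"
  proof (rule push_DIGing_decay[OF smooth' G_def _ G0 Lmax_pos mu alpha_pos no_loops Bt_pos
        connected algorithm[unfolded C_eq] W])
    show "norm (z - \<alpha> *\<^sub>R G z - x_star) \<le> (1 - \<alpha> * mu_bar / 2) * norm (z - x_star)" for z
      by (rule gradient_step_contraction[OF convexF smoothF Lmax_pos _ G0])
         (use mu alpha_pos p \<alpha>mu p1 in auto)
    show "2 * \<alpha> * Lmax \<le> 1" using p p1 by linarith
    have "\<alpha> * mu_bar \<le> 2 * c" using \<alpha>mu pc p(1) by linarith
    then show "\<alpha> * mu_bar \<le> 2 * ((1 / real CARD('n)) ^ (CARD('n) * Bt) / real (CARD('n) * Bt))"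
      by (simp add: c_def M_def)
    \<comment> \<open>The root of kappa in \<open>p\<close> is there for this term: kappa (\<alpha>
      L)^2 = p^2, which is at most p.\<close>
    have "\<alpha> * Lmax * (4 * (Lmax / mu_bar) * (\<alpha> * Lmax)) = 4 * p\<^sup>2"
      using \<kappa> by (simp add: p_def power_mult_distrib flip: kappa_bar) (simp add: power2_eq_square)
    also have "\<dots> \<le> 4 * p" using p p1 by (simp add: power2_eq_square mult_le_cancel_left1)
    finally have "\<alpha> * Lmax * (3 + 4 * (Lmax / mu_bar) * (\<alpha> * Lmax)) \<le> 7 * p"
      using p(3) by (simp add: distrib_left)
    then have "\<alpha> * Lmax * (3 + 4 * (Lmax / mu_bar) * (\<alpha> * Lmax)) * (2 * real M * W) \<le> 7 * p * (2 * real M * W)"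
      using M W1 by (intro mult_right_mono) auto
    \<comment> \<open>The last factor is 1 by \<open>c_eq\<close>; it trades powers of M and n in
      \<open>J0\<close> for c^2.\<close>
    also have "\<dots> = p * J0 * c\<^sup>2 / 4 * (1 / (c * (real M * real CARD('n) ^ M))\<^sup>2)"
      using M c_pos n by (simp add: J0_def field_simps power2_eq_square power3_eq_cube)
        (simp add: mult_2_right power_add)
    also have "\<dots> \<le> c\<^sup>2 / 4"
      using mult_right_mono[OF p(2), of "c\<^sup>2 / 4"] by (simp add: c_eq)
    finally show "\<alpha> * Lmax * (2 * real (CARD('n) * Bt) * W) * (3 + 4 * (Lmax / mu_bar) * (\<alpha> * Lmax))
        \<le> ((1 / real CARD('n)) ^ (CARD('n) * Bt) / real (CARD('n) * Bt))\<^sup>2 / 4"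
      by (simp only: c_def M_def mult_ac)
  qed
  then obtain K where K: "\<And>k. norm (x k - (\<chi> i. x_star)) \<le> K * (1 - \<alpha> * mu_bar / 4) ^ k"
    by blast
  have t: "0 < \<alpha> * mu_bar" "\<alpha> * mu_bar \<le> 1 / 2" using alpha_pos mu \<alpha>mu p1 by auto
  have K0: "K \<ge> 0" using order_trans[OF norm_ge_zero K[of 0]] by simp
  \<comment> \<open>At the largest admissible step-size \<open>rate\<close> equals 1 and its powers
    do not tend to 0, so the limit is taken from the faster decay.\<close>
  have "(\<lambda>k. K * (1 - \<alpha> * mu_bar / 4) ^ k) \<longlonglongrightarrow> 0"
    by (intro tendsto_mult_right_zero LIMSEQ_power_zero) (use t in auto)
  then have "(\<lambda>k. x k - (\<chi> i. x_star)) \<longlonglongrightarrow> 0"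
    by (rule Lim_null_comparison[rotated]) (simp add: K)
  then have lim: "x \<longlonglongrightarrow> (\<chi> i. x_star)" by (simp add: LIM_zero_iff)
  have rate: "1 - \<alpha> * mu_bar / 4 \<le> rate mu_bar \<delta> J2 B \<alpha>"
    by (rule rate_ge[OF mu J2_pos \<delta> delta_less_1 alpha_pos t(2) B])
  have "norm (x k - (\<chi> i. x_star)) \<le> K * rate mu_bar \<delta> J2 B \<alpha> ^ k" for k
    by (rule order_trans[OF K mult_left_mono[OF power_mono[OF rate]]]) (use t K0 in auto)
  with lim show ?thesis by blast
qed

end
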